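(* Let $\sigma\in C^1(\mathbb{R})$ be real-valued with $\sigma_0:=\inf_{z\in\mathbb{R}}\sigma(z)>0$, $\sigma_1:=\sup_{z\in\mathbb{R}}\sigma(z)<2$ and $\partial_z\sigma\in L^\infty(\mathbb{R})$. Then there exists a constant $\mathscr{C}>0$ such that all normalized solutions $\Phi(x,z,t)=(f_+,f_-,g_+,g_-)^T$ of the system $$\partial_tf_+=-\partial_xf_++\tfrac{\sigma(z)}2(f_--f_+),\qquad \partial_tf_-=\partial_xf_--\tfrac{\sigma(z)}2(f_--f_+),$$ $$\partial_tg_+=-\partial_xg_++\tfrac{\sigma(z)}2(g_--g_+)+\tfrac{\partial_z\sigma(z)}2(f_--f_+),$$ $$\partial_tg_-=\partial_xg_--\tfrac{\sigma(z)}2(g_--g_+)-\tfrac{\partial_z\sigma(z)}2(f_--f_+),$$ with $x\in\mathbb{T}^1$, $z\in\mathbb{R}$, $t\ge0$, satisfy, with $\Phi^\infty:=(\tfrac12,\tfrac12,0,0)^T$, $$\sup_{z\in\mathbb{R}}\|\Phi(\cdot,z,t)-\Phi^\infty\|^2_{L^2(0,2\pi;\mathbb{R}^4)}\le\mathscr{C}(1+t^2)e^{-\sigma_0t}\sup_{z\in\mathbb{R}}\|\Phi(\cdot,z,0)-\Phi^\infty\|^2_{L^2(0,2\pi;\mathbb{R}^4)},\qquad t\ge 0.$$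
   Context: $\mathbb{T}^1$ is the one-dimensional torus of length $2\pi$. Here $f_\pm(x,z,t)$ solve the first two equations with initial data $f_\pm(x,z,0)=f_\pm^0(x,z)$, where $f_\pm^0(\cdot,z)\in L^1(\mathbb{T}^1)$ is nonnegative for each parameter $z\in\mathbb{R}$, and $g_\pm:=\partial_zf_\pm$ are the parameter derivatives, solving the last two equations. "Normalized" means $\frac1{2\pi}\int_0^{2\pi}[f_+^0(x,z)+f_-^0(x,z)]\,dx=1$ for all $z\in\mathbb{R}$, and consequently $\int_0^{2\pi}[g_+(x,z,0)+g_-(x,z,0)]\,dx=0$ for all $z\in\mathbb{R}$. The constant $\mathscr{C}$ is independent of the solution, of $z$ and of $t$. *)

theory Defs
  imports "HOL-Analysis.Analysis"
begin

text \<open>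
  The torus of length \<open>2\<pi>\<close> is represented by the fundamental domain \<open>[0, 2\<pi>]\<close> with Lebesgue
  measure. Functions on it matter only up to null sets, so representatives are not required to
  be periodic; the periodicity of the problem is carried by the test functions below.
\<close>

abbreviation torus :: "real measure"
  where "torus \<equiv> lebesgue_on {0..2 * pi}"

definition smooth_periodic :: "(real \<Rightarrow> real) \<Rightarrow> bool"
  where "smooth_periodic \<phi> \<longleftrightarrow>
    (\<forall>n x. (deriv ^^ n) \<phi> differentiable (at x)) \<and> (\<forall>x. \<phi> (x + 2 * pi) = \<phi> x)"

definition pairing :: "(real \<Rightarrow> real) \<Rightarrow> (real \<Rightarrow> real) \<Rightarrow> real"
  where "pairing u \<phi> = (LINT x|torus. u x * \<phi> x)"

text \<open>
  \<open>weak_transport c u S\<close> is the equation \<open>\<partial>\<^sub>t u = - c \<partial>\<^sub>x u + S\<close> on the torus for \<open>t \<ge> 0\<close>, with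
  \<open>u\<close> and \<open>S\<close> integrable in \<open>x\<close> and the derivative \<open>\<partial>\<^sub>x\<close> moved onto the test function
  (initial data are merely integrable, so classical solutions need not exist). The time
  derivative at \<open>t = 0\<close> is one-sided, and the initial datum of \<open>u\<close> is \<open>u x 0\<close>.
\<close>

definition weak_transport ::
    "real \<Rightarrow> (real \<Rightarrow> real \<Rightarrow> real) \<Rightarrow> (real \<Rightarrow> real \<Rightarrow> real) \<Rightarrow> bool"
  where "weak_transport c u S \<longleftrightarrow>
    (\<forall>t\<ge>0. integrable torus (\<lambda>x. u x t) \<and> integrable torus (\<lambda>x. S x t)) \<and>
    (\<forall>\<phi>. smooth_periodic \<phi> \<longrightarrow>
      (\<forall>t\<ge>0. ((\<lambda>s. pairing (\<lambda>x. u x s) \<phi>) has_real_derivative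
          c * pairing (\<lambda>x. u x t) (deriv \<phi>) + pairing (\<lambda>x. S x t) \<phi>) (at t within {0..})))"

text \<open>
  \<open>g = \<partial>\<^sub>z f\<close> for functions of \<open>(x, z)\<close>, as a derivative of \<open>z \<mapsto> f(\<cdot>, z)\<close> tested
  in \<open>x\<close>; this is implied by differentiability of \<open>z \<mapsto> f(\<cdot>, z)\<close> with values in \<open>L\<^sup>1\<close>.
\<close>

definition parameter_derivative ::
    "(real \<Rightarrow> real \<Rightarrow> real) \<Rightarrow> (real \<Rightarrow> real \<Rightarrow> real) \<Rightarrow> bool"
  where "parameter_derivative f g \<longleftrightarrow>
    (\<forall>z. integrable torus (\<lambda>x. f x z) \<and> integrable torus (\<lambda>x. g x z)) \<and>
    (\<forall>\<phi>. smooth_periodic \<phi> \<longrightarrow>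
      (\<forall>z. ((\<lambda>y. pairing (\<lambda>x. f x y) \<phi>) has_real_derivative
          pairing (\<lambda>x. g x z) \<phi>) (at z)))"

text \<open>
  Solutions are functions of \<open>(x, z, t)\<close> with values \<open>\<Phi> = (f\<^sub>+, f\<^sub>-, g\<^sub>+, g\<^sub>-)\<close>.
\<close>

definition goldstein_taylor_solution ::
    "(real \<Rightarrow> real) \<Rightarrow> (real \<Rightarrow> real \<Rightarrow> real \<Rightarrow> real^4) \<Rightarrow> bool"
  where "goldstein_taylor_solution \<sigma> \<Phi> \<longleftrightarrow>
    (let fp = (\<lambda>x z t. \<Phi> x z t $ 1); fm = (\<lambda>x z t. \<Phi> x z t $ 2);
         gp = (\<lambda>x z t. \<Phi> x z t $ 3); gm = (\<lambda>x z t. \<Phi> x z t $ 4)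
     in
      (\<forall>z.
        weak_transport 1 (\<lambda>x t. fp x z t)
          (\<lambda>x t. \<sigma> z / 2 * (fm x z t - fp x z t)) \<and>
        weak_transport (-1) (\<lambda>x t. fm x z t)
          (\<lambda>x t. - (\<sigma> z / 2 * (fm x z t - fp x z t))) \<and>
        weak_transport 1 (\<lambda>x t. gp x z t)
          (\<lambda>x t. \<sigma> z / 2 * (gm x z t - gp x z t) + deriv \<sigma> z / 2 * (fm x z t - fp x z t)) \<and>
        weak_transport (-1) (\<lambda>x t. gm x z t)
          (\<lambda>x t. - (\<sigma> z / 2 * (gm x z t - gp x z t)) - deriv \<sigma> z / 2 * (fm x z t - fp x z t))) \<and>
      (\<forall>t\<ge>0.
        parameter_derivative (\<lambda>x z. fp x z t) (\<lambda>x z. gp x z t) \<and>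
        parameter_derivative (\<lambda>x z. fm x z t) (\<lambda>x z. gm x z t)) \<and>
      (\<forall>z. (AE x in torus. 0 \<le> fp x z 0) \<and> (AE x in torus. 0 \<le> fm x z 0)))"

definition normalized :: "(real \<Rightarrow> real \<Rightarrow> real \<Rightarrow> real^4) \<Rightarrow> bool"
  where "normalized \<Phi> \<longleftrightarrow>
    (\<forall>z. 1 / (2 * pi) * (LINT x|torus. \<Phi> x z 0 $ 1 + \<Phi> x z 0 $ 2) = 1)"

definition Phi_inf :: "real^4"
  where "Phi_inf = vector [1 / 2, 1 / 2, 0, 0]"

text \<open>
  The squared norm of \<open>L\<^sup>2(0, 2\<pi>; \<real>\<^sup>4)\<close>, with value \<open>\<infinity>\<close> for functions that are not square
  integrable.
\<close>

definition L2_norm_sq :: "(real \<Rightarrow> real^4) \<Rightarrow> ennreal"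
  where "L2_norm_sq u = (\<integral>\<^sup>+ x. ennreal ((norm (u x))\<^sup>2) \<partial>torus)"

end

theory Submission
  imports Defs
begin

text \<open>
  The Hartley functions \<open>cas (k x) = cos (k x) + sin (k x)\<close>, \<open>k \<in> \<int>\<close>, are a real orthogonal basis with
  \<open>(cas (k x))' = k cas (- k x)\<close>. Hence for the coefficients \<open>a\<close> of \<open>f\<^sub>+ + f\<^sub>- - 1\<close> at \<open>k\<close> and \<open>b\<close> of
  \<open>f\<^sub>+ - f\<^sub>-\<close> at \<open>-k\<close> the system decouples into \<open>a' = k b\<close>, \<open>b' = - k a - \<sigma> b\<close>, and likewise for \<open>g\<^sub>\<plusminus>\<close>,
  with the additional source \<open>- (\<partial>\<^sub>z \<sigma>) b\<close>. For \<open>k \<noteq> 0\<close> the twisted energy \<open>E = a\<^sup>2 + b\<^sup>2 + (\<sigma> / k) a b\<close>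
  satisfies \<open>E' = - \<sigma> E\<close> exactly and is equivalent to \<open>a\<^sup>2 + b\<^sup>2\<close> uniformly in \<open>k\<close> and \<open>z\<close> because
  \<open>\<sigma> \<le> \<sigma>\<^sub>1 < 2\<close>; the normalization removes \<open>a\<close> for \<open>k = 0\<close>. The source decays at the same rate
  \<open>exp (- \<sigma> t / 2)\<close>, and this resonance produces the factor \<open>1 + t\<^sup>2\<close>. As weak solutions are only
  known to be integrable, square integrability at time \<open>t\<close> is recovered from the square summability
  of the coefficients, by duality with trigonometric polynomials.
\<close>

section \<open>Hartley functions and trigonometric polynomials\<close>

definition cas :: "int \<Rightarrow> real \<Rightarrow> real"
  where "cas k x = cos (of_int k * x) + sin (of_int k * x)"

lemma has_real_derivative_cas:
  "(cas k has_real_derivative of_int k * cas (- k) x) (at x within A)"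
  unfolding cas_def [abs_def]
  by (auto intro!: derivative_eq_intros simp: algebra_simps)

lemma deriv_cas: "deriv (cas k) = (\<lambda>x. of_int k * cas (- k) x)"
  by (intro ext DERIV_imp_deriv has_real_derivative_cas)

lemma cas_0: "cas 0 = (\<lambda>_. 1)"
  by (simp add: cas_def fun_eq_iff)

lemma continuous_on_cas [continuous_intros]: "continuous_on A (cas k)"
  unfolding cas_def [abs_def] by (intro continuous_intros)

lemma abs_cas_le: "\<bar>cas k x\<bar> \<le> 2"
  unfolding cas_def using abs_cos_le_one [of "of_int k * x"] abs_sin_le_one [of "of_int k * x"] by linarith

text \<open>The product equals \<open>cos ((j - k) x) + sin ((j + k) x)\<close>; the cosine is the
  even part of \<open>cas (j - k)\<close> and the sine the odd part of \<open>cas (j + k)\<close>.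
  Written this way, the product stays in the span of the Hartley functions, which gives both
  orthogonality and closure of trigonometric polynomials under multiplication.\<close>

lemma cas_mult:
  "cas j x * cas k x =
    cas (j - k) x / 2 + cas (k - j) x / 2 + cas (j + k) x / 2 - cas (- (j + k)) x / 2"
proof -
  have "cas (j - k) x / 2 + cas (k - j) x / 2 = cos (of_int (j - k) * x)"
    by (simp add: cas_def add_divide_distrib diff_divide_distrib flip: minus_diff_eq [of j k]
        del: minus_diff_eq of_int_diff)
  moreover have "cas (j + k) x / 2 - cas (- (j + k)) x / 2 = sin (of_int (j + k) * x)"
    by (simp add: cas_def add_divide_distrib diff_divide_distrib del: minus_add_distrib of_int_add)
  moreover have "cas j x * cas k x = cos (of_int (j - k) * x) + sin (of_int (j + k) * x)"
    unfolding cas_def of_int_diff of_int_add left_diff_distrib distrib_right cos_diff sin_add by algebra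
  ultimately show ?thesis by simp
qed

lemma cas_periodic: "cas k (x + 2 * pi) = cas k x"
proof -
  have "cas k (x + 2 * pi) = cos (of_int k * x + of_int k * (2 * pi)) + sin (of_int k * x + of_int k * (2 * pi))"
    by (simp add: cas_def ring_distribs)
  then show ?thesis
    unfolding cas_def cos_add sin_add
    using cos_int_2pin [of k] sin_int_2pin [of k] by (simp add: mult_ac)
qed

text \<open>Differentiation only rescales and flips the sign of the frequency, so every iterated
  derivative is again a multiple of some Hartley function. This makes the Hartley functions
  admissible in the weak formulation.\<close>

lemma smooth_periodic_cas: "smooth_periodic (cas k)"
proof -
  have "\<exists>c j. (deriv ^^ n) (cas k) = (\<lambda>x. c * cas j x)" for n
  proof (induction n)
    case 0
    show ?case by (rule exI [of _ 1], rule exI [of _ k]) simp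
  next
    case (Suc n)
    then obtain c j where "(deriv ^^ n) (cas k) = (\<lambda>x. c * cas j x)" by blast
    moreover have "deriv (\<lambda>x. c * cas j x) = (\<lambda>x. (c * of_int j) * cas (- j) x)"
      by (intro ext DERIV_imp_deriv) (auto intro!: derivative_eq_intros has_real_derivative_cas)
    ultimately show ?case by auto
  qed
  moreover have "(\<lambda>x. c * cas j x) differentiable (at x)" for c j x
    by (rule differentiableI [OF has_field_derivative_imp_has_derivative])
       (rule derivative_intros has_real_derivative_cas)+
  ultimately have "(deriv ^^ n) (cas k) differentiable (at x)" for n x
    by metis
  then show ?thesis
    unfolding smooth_periodic_def using cas_periodic by blast
qed

lemma integrable_torus_continuous:
  fixes f :: "real \<Rightarrow> real"
  shows "continuous_on {0..2 * pi} f \<Longrightarrow> integrable torus f"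
  by (rule continuous_imp_integrable_real)

lemma integrable_torus_cas: "integrable torus (cas k)"
  by (intro integrable_torus_continuous continuous_intros)

lemma integral_cas: "(LINT x|torus. cas k x) = (if k = 0 then 2 * pi else 0)"
proof (cases "k = 0")
  case True
  then show ?thesis by (simp add: cas_0 measure_restrict_space)
next
  case False
  have "((\<lambda>x. cas k x) has_integral (- cas (- k) (2 * pi) / of_int k - (- cas (- k) 0 / of_int k))) {0..2 * pi}"
  proof (rule fundamental_theorem_of_calculus)
    fix x :: real
    have "((\<lambda>x. - cas (- k) x / of_int k) has_real_derivative cas k x) (at x within {0..2 * pi})"
      using False by (auto intro!: derivative_eq_intros has_real_derivative_cas)
    then show "((\<lambda>x. - cas (- k) x / of_int k) has_vector_derivative cas k x) (at x within {0..2 * pi})"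
      by (simp add: has_real_derivative_iff_has_vector_derivative)
  qed simp
  then have "integral {0..2 * pi} (cas k) = 0"
    using cas_periodic [of "- k" 0] by (simp add: integral_unique)
  then show ?thesis
    using False lebesgue_integral_eq_integral [OF integrable_torus_cas] by simp
qed

lemma cas_orthogonal: "(LINT x|torus. cas j x * cas k x) = (if j = k then 2 * pi else 0)"
  unfolding cas_mult by (auto simp: integrable_torus_cas integral_cas)

section \<open>The algebra of trigonometric polynomials and its uniform density\<close>

definition trig_poly :: "(real \<Rightarrow> real) \<Rightarrow> bool"
  where "trig_poly p \<longleftrightarrow> (\<exists>K c. finite K \<and> (\<forall>x. p x = (\<Sum>k\<in>K. c k * cas k x)))"

lemma trig_poly_cas: "trig_poly (\<lambda>x. c * cas k x)"
  unfolding trig_poly_def by (rule exI [of _ "{k}"], rule exI [of _ "\<lambda>_. c"]) simp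

lemma trig_poly_add:
  assumes "trig_poly p" "trig_poly q"
  shows "trig_poly (\<lambda>x. p x + q x)"
proof -
  obtain K c L d where K: "finite K" "\<And>x. p x = (\<Sum>k\<in>K. c k * cas k x)"
    and L: "finite L" "\<And>x. q x = (\<Sum>k\<in>L. d k * cas k x)"
    using assms unfolding trig_poly_def by metis
  have "p x + q x = (\<Sum>k\<in>K \<union> L. ((if k \<in> K then c k else 0) + (if k \<in> L then d k else 0)) * cas k x)" for x
  proof -
    have "p x = (\<Sum>k\<in>K \<union> L. if k \<in> K then c k * cas k x else 0)"
      using K L by (simp add: sum.If_cases Int_absorb1)
    moreover have "q x = (\<Sum>k\<in>K \<union> L. if k \<in> L then d k * cas k x else 0)"
      using K L by (simp add: sum.If_cases Int_absorb1)
    ultimately show ?thesis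
      by (simp add: sum.distrib [symmetric]) (intro sum.cong, auto simp: algebra_simps)
  qed
  then show ?thesis
    unfolding trig_poly_def using K(1) L(1)
    by (intro exI [of _ "K \<union> L"] exI [of _ "\<lambda>k. (if k \<in> K then c k else 0) + (if k \<in> L then d k else 0)"]) auto
qed

lemma trig_poly_const: "trig_poly (\<lambda>_. c)"
  using trig_poly_cas [of c 0] by (simp add: cas_0)

lemma trig_poly_sum:
  assumes "finite A" "\<And>i. i \<in> A \<Longrightarrow> trig_poly (p i)"
  shows "trig_poly (\<lambda>x. \<Sum>i\<in>A. p i x)"
  using assms by (induction) (auto intro: trig_poly_const trig_poly_add)

lemma trig_poly_mult:
  assumes "trig_poly p" "trig_poly q"
  shows "trig_poly (\<lambda>x. p x * q x)"
proof -
  obtain K c L d where K: "finite K" "\<And>x. p x = (\<Sum>k\<in>K. c k * cas k x)"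
    and L: "finite L" "\<And>x. q x = (\<Sum>k\<in>L. d k * cas k x)"
    using assms unfolding trig_poly_def by metis
  have "p x * q x = (\<Sum>j\<in>K. \<Sum>k\<in>L. (c j * d k / 2) * cas (j - k) x + (c j * d k / 2) * cas (k - j) x
      + (c j * d k / 2) * cas (j + k) x + (- c j * d k / 2) * cas (- (j + k)) x)" for x
  proof -
    have "p x * q x = (\<Sum>j\<in>K. \<Sum>k\<in>L. c j * d k * (cas j x * cas k x))"
      by (simp add: K L sum_product mult_ac)
    then show ?thesis
      unfolding cas_mult by (simp add: algebra_simps)
  qed
  then show ?thesis
    by (simp only:) (intro trig_poly_sum trig_poly_add trig_poly_cas K L)
qed

lemma trig_poly_cos_sin: "trig_poly cos" "trig_poly sin"
proof -
  have "cos = (\<lambda>x. 1 / 2 * cas 1 x + 1 / 2 * cas (- 1) x)" "sin = (\<lambda>x. 1 / 2 * cas 1 x + (- 1 / 2) * cas (- 1) x)"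
    by (auto simp: cas_def fun_eq_iff field_simps)
  then show "trig_poly cos" "trig_poly sin"
    using trig_poly_add trig_poly_cas by metis+
qed

text \<open>A real-linear functional on the plane restricts to a combination of \<open>cos\<close>
  and \<open>sin\<close> on the unit circle; sums and products stay in the algebra, so induction on
  the polynomial suffices.\<close>

lemma trig_poly_polynomial_on_circle:
  fixes P :: "complex \<Rightarrow> real"
  assumes "real_polynomial_function P"
  shows "trig_poly (\<lambda>x. P (cis x))"
  using assms
proof (induction P)
  case (linear f)
  have "f (cis x) = f 1 * cos x + f \<i> * sin x" for x
  proof -
    have "cis x = cos x *\<^sub>R 1 + sin x *\<^sub>R \<i>"
      by (simp add: complex_eq_iff)
    then show ?thesis
      using linear by (simp add: bounded_linear.linear linear_add linear_cmul)
  qed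
  then show ?case
    by (simp only:) (intro trig_poly_add trig_poly_mult trig_poly_const trig_poly_cos_sin)
qed (auto intro: trig_poly_const trig_poly_add trig_poly_mult)

text \<open>Equal values at the two endpoints let \<open>g\<close> descend to a continuous function
  on the unit circle. Stone-Weierstrass approximates that function by a polynomial in the plane,
  whose pullback along \<open>cis\<close> is a trigonometric polynomial.\<close>

lemma trig_poly_dense:
  fixes g :: "real \<Rightarrow> real"
  assumes "continuous_on {0..2 * pi} g" "g 0 = g (2 * pi)" "e > 0"
  shows "\<exists>p. trig_poly p \<and> (\<forall>x\<in>{0..2 * pi}. \<bar>g x - p x\<bar> < e)"
proof -
  have cis_im: "cis ` {0..2 * pi} = sphere 0 1"
  proof
    show "sphere 0 1 \<subseteq> cis ` {0..2 * pi}"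
    proof
      fix z :: complex assume "z \<in> sphere 0 1"
      then have "z = cis (Arg2pi z)"
        using Arg2pi_eq [of z] by (simp add: cis_conv_exp)
      then show "z \<in> cis ` {0..2 * pi}"
        using Arg2pi_ge_0 [of z] Arg2pi_lt_2pi [of z] by (metis atLeastAtMost_iff imageI less_imp_le)
    qed
  qed auto
  have Arg: "g (Arg2pi (cis x)) = g x" if "x \<in> {0..2 * pi}" for x
  proof (cases "x = 2 * pi")
    case True
    then have "cis x = 1" by (simp add: complex_eq_iff)
    then show ?thesis using True assms(2) by (simp add: Arg2pi_of_real [of 1, simplified])
  next
    case False
    then have "Arg2pi (cis x) = x"
      using that by (intro Arg2pi_unique [of 1]) (auto simp: cis_conv_exp)
    then show ?thesis by simp
  qed
  \<comment> \<open>\<open>Arg2pi\<close> jumps at 1, so continuity on the circle cannot come from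
    composition. Instead, \<open>cis\<close> maps a compact space continuously onto a Hausdorff one
    and is therefore a quotient map, and continuity may be checked after composing with it.\<close>
  have "quotient_map (top_of_set {0..2 * pi}) (top_of_set (sphere 0 1)) cis"
    unfolding cis_im [symmetric]
    by (intro continuous_imp_quotient_map)
       (auto simp: compact_space_subtopology Hausdorff_space_subtopology intro!: continuous_on_cis continuous_on_id)
  moreover have "continuous_map (top_of_set {0..2 * pi}) euclidean ((\<lambda>z. g (Arg2pi z)) \<circ> cis)"
    using continuous_on_eq [OF assms(1), of "(\<lambda>z. g (Arg2pi z)) \<circ> cis"] Arg by simp
  ultimately have "continuous_on (sphere 0 1) (\<lambda>z. g (Arg2pi z))"
    by (subst continuous_map_iff_continuous [symmetric]) (rule continuous_compose_quotient_map)
  then obtain P where P: "polynomial_function P" "\<And>z. z \<in> sphere 0 1 \<Longrightarrow> norm (g (Arg2pi z) - P z) < e"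
    using Stone_Weierstrass_polynomial_function [of "sphere 0 1 :: complex set" "\<lambda>z. g (Arg2pi z)" e] assms(3)
    by auto
  have "trig_poly (\<lambda>x. P (cis x))"
    using P(1) by (intro trig_poly_polynomial_on_circle) (simp add: real_polynomial_function_eq)
  moreover have "\<bar>g x - P (cis x)\<bar> < e" if "x \<in> {0..2 * pi}" for x
    using P(2) [of "cis x"] Arg [OF that] by simp
  ultimately show ?thesis by blast
qed

section \<open>Square integrability and Hartley coefficients\<close>

lemma integrable_torus_mult:
  fixes u g :: "real \<Rightarrow> real"
  assumes "integrable torus u" "g \<in> borel_measurable torus" "\<And>x. x \<in> {0..2 * pi} \<Longrightarrow> \<bar>g x\<bar> \<le> B"
  shows "integrable torus (\<lambda>x. u x * g x)"
proof (rule Bochner_Integration.integrable_bound [where f = "\<lambda>x. B * u x"])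
  show "integrable torus (\<lambda>x. B * u x)" using assms(1) by simp
  show "(\<lambda>x. u x * g x) \<in> borel_measurable torus" using assms(1,2) by measurable
  show "AE x in torus. norm (u x * g x) \<le> norm (B * u x)"
  proof (rule AE_I2)
    fix x assume "x \<in> space torus"
    then have "x \<in> {0..2 * pi}" by simp
    then have "\<bar>g x\<bar> \<le> \<bar>B\<bar>" using assms(3) [of x] by linarith
    then show "norm (u x * g x) \<le> norm (B * u x)"
      by (auto simp: abs_mult mult.commute [of "\<bar>u x\<bar>"] intro: mult_right_mono)
  qed
qed

lemma integrable_torus_mult_cas:
  assumes "integrable torus u"
  shows "integrable torus (\<lambda>x. u x * cas k x)"
  using assms integrable_torus_cas abs_cas_le by (intro integrable_torus_mult) auto

lemma pairing_trig_sum: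
  assumes "integrable torus u"
  shows "pairing u (\<lambda>x. \<Sum>k\<in>K. c k * cas k x) = (\<Sum>k\<in>K. c k * pairing u (cas k))"
proof -
  have "pairing u (\<lambda>x. \<Sum>k\<in>K. c k * cas k x) = (LINT x|torus. (\<Sum>k\<in>K. c k * (u x * cas k x)))"
    unfolding pairing_def by (simp add: sum_distrib_left mult_ac)
  also have "\<dots> = (\<Sum>k\<in>K. c k * pairing u (cas k))"
    unfolding pairing_def
    by (subst Bochner_Integration.integral_sum) (auto intro!: integrable_torus_mult_cas assms)
  finally show ?thesis .
qed

lemma pairing_commute: "pairing u v = pairing v u"
  by (simp add: pairing_def mult.commute)

lemma pairing_trig_sum_self:
  assumes "finite K"
  shows "pairing (\<lambda>x. \<Sum>k\<in>K. c k * cas k x) (\<lambda>x. \<Sum>k\<in>K. c k * cas k x) = 2 * pi * (\<Sum>k\<in>K. (c k)\<^sup>2)"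
proof -
  let ?p = "\<lambda>x. \<Sum>k\<in>K. c k * cas k x"
  have i: "integrable torus ?p"
    by (intro integrable_torus_continuous continuous_intros)
  have "pairing ?p (cas k) = c k * (2 * pi)" if "k \<in> K" for k
  proof -
    have "pairing ?p (cas k) = (\<Sum>j\<in>K. c j * pairing (cas k) (cas j))"
      by (subst pairing_commute) (rule pairing_trig_sum [OF integrable_torus_cas])
    also have "\<dots> = (\<Sum>j\<in>K. if k = j then c j * (2 * pi) else 0)"
      unfolding pairing_def cas_orthogonal by (intro sum.cong) auto
    finally show ?thesis using that assms by simp
  qed
  then show ?thesis
    unfolding pairing_trig_sum [OF i] by (simp add: sum_distrib_left power2_eq_square mult_ac)
qed

text \<open>Expand the nonnegative integral of \<open>(u - p)\<close> squared, where
  \<open>p\<close> is the orthogonal projection of \<open>u\<close> onto the span of the chosen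
  modes. Each mode has squared norm \<open>2 * pi\<close>, which explains the divisor in the
  coefficients and the factor in the bound.\<close>

lemma bessel_cas:
  assumes u: "integrable torus u" and u2: "integrable torus (\<lambda>x. (u x)\<^sup>2)" and "finite K"
  shows "(\<Sum>k\<in>K. (pairing u (cas k))\<^sup>2) \<le> 2 * pi * (LINT x|torus. (u x)\<^sup>2)"
proof -
  define c where "c k = pairing u (cas k) / (2 * pi)" for k
  define p where "p x = (\<Sum>k\<in>K. c k * cas k x)" for x
  have pc: "continuous_on {0..2 * pi} p"
    unfolding p_def by (intro continuous_intros)
  have p2: "integrable torus (\<lambda>x. (p x)\<^sup>2)"
    by (intro integrable_torus_continuous continuous_intros pc)
  have up: "integrable torus (\<lambda>x. u x * p x)"
    unfolding p_def sum_distrib_left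
    by (intro Bochner_Integration.integrable_sum)
       (use integrable_torus_mult_cas [OF u] in \<open>simp add: mult.left_commute\<close>)
  have "0 \<le> (LINT x|torus. (u x - p x)\<^sup>2)"
    by (intro integral_nonneg_AE) auto
  also have "\<dots> = (LINT x|torus. (u x)\<^sup>2 - 2 * (u x * p x) + (p x)\<^sup>2)"
    by (intro Bochner_Integration.integral_cong) (auto simp: power2_diff)
  also have "\<dots> = (LINT x|torus. (u x)\<^sup>2) - 2 * pairing u p + pairing p p"
    using u2 up p2 by (simp add: pairing_def power2_eq_square)
  also have "pairing u p = 2 * pi * (\<Sum>k\<in>K. (c k)\<^sup>2)"
    unfolding p_def [abs_def] pairing_trig_sum [OF u]
    by (simp add: c_def sum_distrib_left power2_eq_square)
  also have "pairing p p = 2 * pi * (\<Sum>k\<in>K. (c k)\<^sup>2)"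
    unfolding p_def [abs_def] by (rule pairing_trig_sum_self [OF \<open>finite K\<close>])
  also have "(\<Sum>k\<in>K. (c k)\<^sup>2) = (\<Sum>k\<in>K. (pairing u (cas k))\<^sup>2) / (2 * pi)\<^sup>2"
    by (simp add: c_def power_divide sum_divide_distrib)
  finally show ?thesis
    by (simp add: field_simps power2_eq_square)
qed

section \<open>Duality: from trigonometric polynomials to bounded measurable test functions\<close>

lemma pairing_bound_trig_poly:
  assumes u: "integrable torus u"
    and M: "\<And>K. finite K \<Longrightarrow> (\<Sum>k\<in>K. (pairing u (cas k))\<^sup>2) \<le> 2 * pi * C"
    and "trig_poly p"
  shows "(pairing u p)\<^sup>2 \<le> C * pairing p p"
proof -
  obtain K c where K: "finite K" "p = (\<lambda>x. \<Sum>k\<in>K. c k * cas k x)"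
    using assms(3) unfolding trig_poly_def by blast
  \<comment> \<open>The pairing is a finite sum of products of coefficients, so Cauchy-Schwarz
    applies to the coefficients; square integrability of \<open>u\<close>, which is not known here,
    is never invoked.\<close>
  have "(pairing u p)\<^sup>2 \<le> (\<Sum>k\<in>K. (c k)\<^sup>2) * (\<Sum>k\<in>K. (pairing u (cas k))\<^sup>2)"
    unfolding K pairing_trig_sum [OF u] by (rule Cauchy_Schwarz_ineq_sum)
  also have "\<dots> \<le> (\<Sum>k\<in>K. (c k)\<^sup>2) * (2 * pi * C)"
    using M [OF K(1)] by (intro mult_left_mono sum_nonneg) auto
  also have "\<dots> = C * pairing p p"
    unfolding K(2) pairing_trig_sum_self [OF K(1)] by simp
  finally show ?thesis .
qed

text \<open>Both sides pass to the limit by dominated convergence, with majorants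
  \<open>\<bar>B\<bar> * \<bar>u x\<bar>\<close> and \<open>\<bar>B\<bar> * \<bar>B\<bar>\<close>.
  The uniform bound on the test functions provides the first majorant when \<open>u\<close> is
  merely integrable.\<close>

lemma pairing_bound_limit:
  assumes u: "integrable torus u"
    and g: "\<And>n::nat. g n \<in> borel_measurable torus" "\<And>n x. x \<in> {0..2 * pi} \<Longrightarrow> \<bar>g n x\<bar> \<le> B"
    and lim: "AE x in torus. (\<lambda>n. g n x) \<longlonglongrightarrow> h x" and h: "h \<in> borel_measurable torus"
    and bound: "\<And>n. (pairing u (g n))\<^sup>2 \<le> C * pairing (g n) (g n)"
  shows "(pairing u h)\<^sup>2 \<le> C * pairing h h"
proof -
  have B: "\<bar>g n x\<bar> \<le> \<bar>B\<bar>" if "x \<in> {0..2 * pi}" for n x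
    using g(2) [OF that, of n] by linarith
  have um: "u \<in> borel_measurable torus" using u by simp
  have "(\<lambda>n. pairing u (g n)) \<longlonglongrightarrow> pairing u h"
    unfolding pairing_def
  proof (rule integral_dominated_convergence)
    show "integrable torus (\<lambda>x. \<bar>B\<bar> * \<bar>u x\<bar>)" using u by simp
    show "AE x in torus. (\<lambda>n. u x * g n x) \<longlonglongrightarrow> u x * h x"
      using lim by eventually_elim (intro tendsto_intros)
    show "AE x in torus. norm (u x * g n x) \<le> \<bar>B\<bar> * \<bar>u x\<bar>" for n
    proof (rule AE_I2)
      fix x assume "x \<in> space torus"
      then show "norm (u x * g n x) \<le> \<bar>B\<bar> * \<bar>u x\<bar>"
        using B [of x n] by (auto simp: abs_mult mult.commute [of "\<bar>u x\<bar>"] intro: mult_right_mono)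
    qed
  qed (use um g h in measurable)
  then have l: "(\<lambda>n. (pairing u (g n))\<^sup>2) \<longlonglongrightarrow> (pairing u h)\<^sup>2"
    by (intro tendsto_intros)
  have "(\<lambda>n. pairing (g n) (g n)) \<longlonglongrightarrow> pairing h h"
    unfolding pairing_def
  proof (rule integral_dominated_convergence)
    show "integrable torus (\<lambda>x. \<bar>B\<bar> * \<bar>B\<bar>)" by (intro integrable_torus_continuous continuous_intros)
    show "AE x in torus. (\<lambda>n. g n x * g n x) \<longlonglongrightarrow> h x * h x"
      using lim by eventually_elim (intro tendsto_intros)
    show "AE x in torus. norm (g n x * g n x) \<le> \<bar>B\<bar> * \<bar>B\<bar>" for n
    proof (rule AE_I2)
      fix x assume "x \<in> space torus"
      then show "norm (g n x * g n x) \<le> \<bar>B\<bar> * \<bar>B\<bar>"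
        using B [of x n] unfolding real_norm_def abs_mult by (intro mult_mono) auto
    qed
  qed (use g h in measurable)
  then have r: "(\<lambda>n. C * pairing (g n) (g n)) \<longlonglongrightarrow> C * pairing h h"
    by (intro tendsto_intros)
  show ?thesis
    by (rule LIMSEQ_le [OF l r]) (use bound in auto)
qed

lemma continuous_measurable_torus:
  fixes g :: "real \<Rightarrow> real"
  shows "continuous_on {0..2 * pi} g \<Longrightarrow> g \<in> borel_measurable torus"
  by (intro continuous_imp_measurable_on_sets_lebesgue) auto

text \<open>Uniform approximation by trigonometric polynomials with error \<open>1 / Suc n\<close>
  gives pointwise convergence together with the common bound \<open>B + 1\<close>.\<close>

lemma pairing_bound_continuous:
  assumes u: "integrable torus u"
    and M: "\<And>K. finite K \<Longrightarrow> (\<Sum>k\<in>K. (pairing u (cas k))\<^sup>2) \<le> 2 * pi * C"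
    and g: "continuous_on {0..2 * pi} g" "g 0 = g (2 * pi)"
  shows "(pairing u g)\<^sup>2 \<le> C * pairing g g"
proof -
  have "\<exists>p. trig_poly p \<and> (\<forall>x\<in>{0..2 * pi}. \<bar>g x - p x\<bar> < 1 / real (Suc n))" for n
    using trig_poly_dense [OF g, of "1 / real (Suc n)"] by simp
  then obtain p where p: "\<And>n. trig_poly (p n)"
      "\<And>n x. x \<in> {0..2 * pi} \<Longrightarrow> \<bar>g x - p n x\<bar> < 1 / real (Suc n)"
    by metis
  obtain B where B: "\<And>x. x \<in> {0..2 * pi} \<Longrightarrow> \<bar>g x\<bar> \<le> B"
    using compact_imp_bounded [OF compact_continuous_image [OF g(1)]] unfolding bounded_iff by fastforce
  show ?thesis
  proof (rule pairing_bound_limit [OF u])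
    show "p n \<in> borel_measurable torus" for n
    proof -
      obtain K c where K: "p n = (\<lambda>x. \<Sum>k\<in>K. c k * cas k x)"
        using p(1) [of n] unfolding trig_poly_def by blast
      show ?thesis unfolding K by (intro continuous_measurable_torus continuous_intros)
    qed
    show "\<bar>p n x\<bar> \<le> B + 1" if "x \<in> {0..2 * pi}" for n x
    proof -
      have "1 / real (Suc n) \<le> 1" by simp
      then show ?thesis using p(2) [OF that, of n] B [OF that] by linarith
    qed
    show "AE x in torus. (\<lambda>n. p n x) \<longlonglongrightarrow> g x"
    proof (rule AE_I2)
      fix x assume "x \<in> space torus"
      then have x: "x \<in> {0..2 * pi}" by simp
      have "(\<lambda>n. g x - p n x) \<longlonglongrightarrow> 0"
        by (rule Lim_null_comparison [OF _ LIMSEQ_Suc [OF lim_1_over_n]])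
           (use p(2) [OF x] in \<open>auto intro!: always_eventually less_imp_le\<close>)
      from tendsto_diff [OF tendsto_const this, of "g x"] show "(\<lambda>n. p n x) \<longlonglongrightarrow> g x" by simp
    qed
    show "g \<in> borel_measurable torus" by (rule continuous_measurable_torus [OF g(1)])
    show "(pairing u (p n))\<^sup>2 \<le> C * pairing (p n) (p n)" for n
      by (rule pairing_bound_trig_poly [OF u M p(1)])
  qed
qed

text \<open>A measurable function is almost everywhere a limit of continuous ones. These can be
  modified to be uniformly bounded and to vanish at both endpoints without changing the limit, so
  the continuous case applies to each of them.\<close>

lemma pairing_bound_bounded:
  assumes u: "integrable torus u"
    and M: "\<And>K. finite K \<Longrightarrow> (\<Sum>k\<in>K. (pairing u (cas k))\<^sup>2) \<le> 2 * pi * C"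
    and g: "g \<in> borel_measurable torus" "\<And>x. x \<in> {0..2 * pi} \<Longrightarrow> \<bar>g x\<bar> \<le> B"
  shows "(pairing u g)\<^sup>2 \<le> C * pairing g g"
proof -
  have "g measurable_on {0..2 * pi}"
    using g(1) by (simp add: measurable_on_iff_borel_measurable)
  then obtain N h where N: "negligible N" and h: "\<And>n. continuous_on UNIV (h n)"
    and lim: "\<And>x. x \<notin> N \<Longrightarrow> (\<lambda>n::nat. h n x) \<longlonglongrightarrow> (if x \<in> {0..2 * pi} then g x else 0)"
    unfolding measurable_on_def by blast
  \<comment> \<open>Truncation, and a cutoff that makes the values at \<open>0\<close> and \<open>2\<pi>\<close> agree.\<close>
  define w where "w n x = min 1 (real n * min x (2 * pi - x)) * max (- B) (min B (h n x))" for n x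
  have wc: "continuous_on {0..2 * pi} (w n)" for n
    unfolding w_def by (intro continuous_intros continuous_on_subset [OF h]) auto
  have B: "0 \<le> B" using g(2) [of 0] by auto
  show ?thesis
  proof (rule pairing_bound_limit [OF u])
    show "w n \<in> borel_measurable torus" for n
      by (rule continuous_measurable_torus [OF wc])
    show "\<bar>w n x\<bar> \<le> 1 * B" if "x \<in> {0..2 * pi}" for n x
      unfolding w_def abs_mult
    proof (intro mult_mono)
      have "0 \<le> real n * min x (2 * pi - x)" using that by (intro mult_nonneg_nonneg) auto
      then show "\<bar>min 1 (real n * min x (2 * pi - x))\<bar> \<le> 1" by auto
    qed (use B in auto)
    show "AE x in torus. (\<lambda>n. w n x) \<longlonglongrightarrow> g x"
    proof -
      \<comment> \<open>The endpoints join the exceptional set because the cutoff vanishes there for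
        every \<open>n\<close>. At any interior point it equals 1 once \<open>n\<close> is at least
        \<open>1 / d\<close>.\<close>
      have "negligible (N \<union> {0, 2 * pi})"
        using N by (simp add: negligible_Un_eq)
      then have "AE x in lebesgue. x \<notin> N \<union> {0, 2 * pi}"
        using AE_not_in negligible_iff_null_sets by blast
      then have "AE x in lebesgue. x \<in> {0..2 * pi} \<longrightarrow> (\<lambda>n. w n x) \<longlonglongrightarrow> g x"
      proof (eventually_elim, intro impI)
        fix x assume x: "x \<notin> N \<union> {0, 2 * pi}" "x \<in> {0..2 * pi}"
        define d where "d = min x (2 * pi - x)"
        have d: "d > 0" using x by (auto simp: d_def)
        have "\<forall>\<^sub>F n in sequentially. 1 / d \<le> real n"
          using filterlim_real_sequentially unfolding filterlim_at_top by blast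
        then have "\<forall>\<^sub>F n in sequentially. w n x = max (- B) (min B (h n x))"
          by eventually_elim (use d in \<open>simp add: w_def min_absorb1 pos_divide_le_eq flip: d_def\<close>)
        moreover have "(\<lambda>n. max (- B) (min B (h n x))) \<longlonglongrightarrow> max (- B) (min B (g x))"
          using lim [of x] x by (intro tendsto_intros) auto
        moreover have "max (- B) (min B (g x)) = g x"
          using g(2) [OF x(2)] by auto
        ultimately show "(\<lambda>n. w n x) \<longlonglongrightarrow> g x"
          by (simp add: tendsto_cong)
      qed
      then show ?thesis by (simp add: AE_restrict_space_iff)
    qed
    show "g \<in> borel_measurable torus" by (rule g(1))
    show "(pairing u (w n))\<^sup>2 \<le> C * pairing (w n) (w n)" for n
      by (rule pairing_bound_continuous [OF u M wc]) (auto simp: w_def)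
  qed
qed

text \<open>Test \<open>u\<close> against its own truncations \<open>v n\<close>: the pairing of
  \<open>u\<close> with \<open>v n\<close> is the squared norm of \<open>v n\<close>, so the duality
  bound says that this squared norm, squared, is at most \<open>C\<close> times itself. Hence it is
  at most \<open>C\<close>, and monotone convergence in \<open>n\<close> recovers
  \<open>u\<close>.\<close>

lemma nn_integral_square_le_of_coefficients:
  assumes u: "integrable torus u"
    and M: "\<And>K. finite K \<Longrightarrow> (\<Sum>k\<in>K. (pairing u (cas k))\<^sup>2) \<le> 2 * pi * C"
  shows "(\<integral>\<^sup>+ x. ennreal ((u x)\<^sup>2) \<partial>torus) \<le> ennreal C"
proof -
  have C: "0 \<le> C" using M [of "{}"] pi_gt_zero by (simp add: zero_le_mult_iff)
  define v where "v n x = (if \<bar>u x\<bar> \<le> real n then u x else 0)" for n x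
  have um [measurable]: "u \<in> borel_measurable torus" using u by simp
  have vm [measurable]: "v n \<in> borel_measurable torus" for n unfolding v_def by measurable
  have vb: "\<bar>v n x\<bar> \<le> real n" for n x by (simp add: v_def)
  have le: "(\<integral>\<^sup>+ x. ennreal ((v n x)\<^sup>2) \<partial>torus) \<le> ennreal C" for n
  proof -
    have i: "integrable torus (\<lambda>x. u x * v n x)"
      by (rule integrable_torus_mult [OF u vm vb])
    have eq: "u x * v n x = (v n x)\<^sup>2" "v n x * v n x = (v n x)\<^sup>2" for x
      by (auto simp: v_def power2_eq_square)
    have "(pairing u (v n))\<^sup>2 \<le> C * pairing (v n) (v n)"
      by (rule pairing_bound_bounded [OF u M vm vb])
    then have "(LINT x|torus. (v n x)\<^sup>2) * (LINT x|torus. (v n x)\<^sup>2) \<le> C * (LINT x|torus. (v n x)\<^sup>2)"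
      unfolding pairing_def eq by (simp add: power2_eq_square)
    moreover have "0 \<le> (LINT x|torus. (v n x)\<^sup>2)" by simp
    ultimately have "(LINT x|torus. (v n x)\<^sup>2) \<le> C"
      using C by (cases "(LINT x|torus. (v n x)\<^sup>2) = 0") (auto dest: mult_right_le_imp_le)
    moreover have "(\<integral>\<^sup>+ x. ennreal ((v n x)\<^sup>2) \<partial>torus) = ennreal (LINT x|torus. (v n x)\<^sup>2)"
      using i unfolding eq by (intro nn_integral_eq_integral) auto
    ultimately show ?thesis by (simp add: ennreal_leI)
  qed
  have "(\<integral>\<^sup>+ x. ennreal ((u x)\<^sup>2) \<partial>torus) \<le> (\<integral>\<^sup>+ x. (SUP n. ennreal ((v n x)\<^sup>2)) \<partial>torus)"
  proof (rule nn_integral_mono)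
    fix x
    obtain n where "\<bar>u x\<bar> \<le> real n" using real_arch_simple by blast
    then show "ennreal ((u x)\<^sup>2) \<le> (SUP n. ennreal ((v n x)\<^sup>2))"
      by (intro SUP_upper2 [of n]) (auto simp: v_def)
  qed
  also have "\<dots> = (SUP n. \<integral>\<^sup>+ x. ennreal ((v n x)\<^sup>2) \<partial>torus)"
  proof (rule nn_integral_monotone_convergence_SUP)
    show "incseq (\<lambda>n x. ennreal ((v n x)\<^sup>2))"
      by (intro incseq_SucI le_funI ennreal_leI) (auto simp: v_def)
  qed measurable
  also have "\<dots> \<le> ennreal C" using le by (intro SUP_least)
  finally show ?thesis .
qed

section \<open>Decay of a single mode\<close>

text \<open>The forcing is of order \<open>exp (- s * t / 2) * sqrt (F t)\<close>, in resonance with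
  the decay. For \<open>Y = exp (s * t) * F\<close> this means
  \<open>Y' \<le> 2 * sqrt (m * Y)\<close>, so \<open>sqrt Y\<close> gains at most
  \<open>sqrt m * t\<close>; squaring the sum costs the factor 2 and yields the quadratic growth.
  The choice \<open>m = 0\<close> covers the unforced energy.\<close>

lemma forced_decay:
  fixes F F' h :: "real \<Rightarrow> real"
  assumes dF: "\<And>t. t \<ge> 0 \<Longrightarrow> (F has_real_derivative F' t) (at t within {0..})"
    and F: "\<And>t. t \<ge> 0 \<Longrightarrow> 0 \<le> F t"
    and F': "\<And>t. t \<ge> 0 \<Longrightarrow> F' t \<le> - s * F t + h t"
    and h: "\<And>t. t \<ge> 0 \<Longrightarrow> (h t)\<^sup>2 \<le> 4 * m * exp (- s * t) * F t"
    and m: "0 \<le> m" and t: "t \<ge> 0"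
  shows "F t \<le> 2 * (F 0 + m * t\<^sup>2) * exp (- s * t)"
proof -
  define Y where "Y r = exp (s * r) * F r" for r
  define Y' where "Y' r = exp (s * r) * (F' r + s * F r)" for r
  have Y0: "0 \<le> Y r" if "r \<ge> 0" for r
    using F [OF that] by (simp add: Y_def)
  have dY: "(Y has_real_derivative Y' r) (at r within {0..})" if "r \<ge> 0" for r
    unfolding Y_def [abs_def] Y'_def
    by (auto intro!: derivative_eq_intros dF [OF that] simp: algebra_simps)
  have Y'_le: "Y' r \<le> 2 * sqrt m * sqrt (Y r)" if r: "r \<ge> 0" for r
  proof -
    have "Y' r \<le> exp (s * r) * h r"
      unfolding Y'_def using F' [OF r] by (intro mult_left_mono) auto
    also have "\<dots> \<le> sqrt (4 * m * Y r)"
    proof (rule real_le_rsqrt)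
      have "(exp (s * r) * h r)\<^sup>2 \<le> (exp (s * r))\<^sup>2 * (4 * m * exp (- s * r) * F r)"
        unfolding power_mult_distrib using h [OF r] by (intro mult_left_mono) auto
      also have "\<dots> = 4 * m * Y r"
        by (simp add: Y_def power2_eq_square exp_minus)
      finally show "(exp (s * r) * h r)\<^sup>2 \<le> 4 * m * Y r" .
    qed
    finally show ?thesis by (simp add: real_sqrt_mult)
  qed
  have "Y t \<le> 2 * (Y 0 + m * t\<^sup>2) + e" if e: "e > 0" for e
  proof -
    define d where "d = e / 2"
    have d: "d > 0" using e by (simp add: d_def)
    \<comment> \<open>\<open>Y' \<le> 2 sqrt (m Y)\<close> makes \<open>sqrt Y\<close> grow at most linearly; \<open>d\<close> avoids the singularity of \<open>sqrt\<close> at 0.\<close>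
    define R where "R r = sqrt (Y r + d) - sqrt m * r" for r
    have "R 0 \<ge> R t"
    proof (rule DERIV_nonpos_imp_decreasing_open [OF t])
      show "continuous_on {0..t} R"
        unfolding R_def
        by (intro continuous_intros continuous_on_subset [OF DERIV_continuous_on [OF dY]]) auto
      fix r assume r: "0 < r" "r < t"
      have pos: "Y r + d > 0" using Y0 [of r] r d by simp
      \<comment> \<open>The derivative is given within \<open>{0..}\<close>; at an interior time it
        is two-sided, as the monotonicity criterion demands.\<close>
      have "(Y has_real_derivative Y' r) (at r)"
        using DERIV_subset [OF dY, of r "{0<..}"] r by (simp add: at_within_open [of r "{0<..}"] subset_iff)
      then have "(R has_real_derivative Y' r * (inverse (sqrt (Y r + d)) / 2) - sqrt m) (at r)"
        unfolding R_def [abs_def] using pos by (auto intro!: derivative_eq_intros)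
      moreover have "Y' r * (inverse (sqrt (Y r + d)) / 2) \<le> sqrt m"
      proof -
        have "Y' r \<le> 2 * sqrt m * sqrt (Y r)" using Y'_le r by simp
        also have "\<dots> \<le> 2 * sqrt m * sqrt (Y r + d)"
          using m d by (intro mult_left_mono) auto
        finally show ?thesis using pos by (simp add: field_simps)
      qed
      ultimately show "\<exists>y. (R has_real_derivative y) (at r) \<and> y \<le> 0" by force
    qed
    then have "sqrt (Y t + d) \<le> sqrt (Y 0 + d) + sqrt m * t"
      by (simp add: R_def)
    then have "(sqrt (Y t + d))\<^sup>2 \<le> (sqrt (Y 0 + d) + sqrt m * t)\<^sup>2"
      using Y0 [OF t] d by (intro power_mono) auto
    also have "\<dots> \<le> 2 * (sqrt (Y 0 + d))\<^sup>2 + 2 * (sqrt m * t)\<^sup>2"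
      using sum_squares_bound [of "sqrt (Y 0 + d)" "sqrt m * t"] by (simp add: power2_sum)
    finally show ?thesis
      using Y0 [OF t] Y0 [of 0] d m by (simp add: power_mult_distrib d_def field_simps)
  qed
  then have "Y t \<le> 2 * (Y 0 + m * t\<^sup>2)"
    by (rule field_le_epsilon)
  then show ?thesis
    by (simp add: Y_def exp_minus field_simps)
qed

text \<open>Since \<open>2 * \<bar>a * b\<bar>\<close> is at most the sum of the squares, the cross
  term is at most \<open>s / 2\<close> times that sum. The lower constant is positive exactly when
  \<open>s < 2\<close>.\<close>

lemma twisted_energy_bounds:
  fixes a b \<mu> :: real
  assumes "\<bar>\<mu>\<bar> \<le> s" "s \<le> 2"
  shows "(1 - s / 2) * (a\<^sup>2 + b\<^sup>2) \<le> a\<^sup>2 + b\<^sup>2 + \<mu> * (a * b)"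
    and "a\<^sup>2 + b\<^sup>2 + \<mu> * (a * b) \<le> 2 * (a\<^sup>2 + b\<^sup>2)"
proof -
  have "2 * \<bar>a * b\<bar> \<le> a\<^sup>2 + b\<^sup>2"
    using sum_squares_bound [of "\<bar>a\<bar>" "\<bar>b\<bar>"] by (simp add: abs_mult)
  then have "\<bar>\<mu>\<bar> * (2 * \<bar>a * b\<bar>) \<le> s * (a\<^sup>2 + b\<^sup>2)"
    using assms by (intro mult_mono) auto
  then have "\<bar>2 * (\<mu> * (a * b))\<bar> \<le> s * (a\<^sup>2 + b\<^sup>2)"
    by (simp add: abs_mult)
  then have bounds: "- s * (a\<^sup>2 + b\<^sup>2) \<le> 2 * (\<mu> * (a * b))" "2 * (\<mu> * (a * b)) \<le> s * (a\<^sup>2 + b\<^sup>2)"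
    by (simp_all only: abs_le_iff mult_minus_left) simp_all
  then show "(1 - s / 2) * (a\<^sup>2 + b\<^sup>2) \<le> a\<^sup>2 + b\<^sup>2 + \<mu> * (a * b)"
    by (simp add: algebra_simps)
  have "2 * (\<mu> * (a * b)) \<le> 2 * (a\<^sup>2 + b\<^sup>2)"
    using assms by (intro order_trans [OF bounds(2)] mult_right_mono) auto
  then show "a\<^sup>2 + b\<^sup>2 + \<mu> * (a * b) \<le> 2 * (a\<^sup>2 + b\<^sup>2)"
    by simp
qed

text \<open>\<open>forced_decay\<close> is used twice: without forcing for the energy
  \<open>E\<close> of \<open>(a, b)\<close>, then for the energy \<open>F\<close> of
  \<open>(p, q)\<close>, whose forcing is controlled by the decay of \<open>E\<close>. The factor 2
  of that lemma, the factor 2 from the upper energy bound and division by \<theta> give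
  \<open>4 / \<theta>\<close>; the term \<open>2 * m / \<theta>\<close> gives the coefficient with
  \<theta> cubed.\<close>

lemma mode_decay:
  fixes a b p q :: "real \<Rightarrow> real" and s d D \<theta> :: real and k :: int
  assumes a: "\<And>t. t \<ge> 0 \<Longrightarrow> (a has_real_derivative of_int k * b t) (at t within {0..})"
    and b: "\<And>t. t \<ge> 0 \<Longrightarrow> (b has_real_derivative - of_int k * a t - s * b t) (at t within {0..})"
    and p: "\<And>t. t \<ge> 0 \<Longrightarrow> (p has_real_derivative of_int k * q t) (at t within {0..})"
    and q: "\<And>t. t \<ge> 0 \<Longrightarrow> (q has_real_derivative - of_int k * p t - s * q t - d * b t) (at t within {0..})"
    and mean: "k = 0 \<Longrightarrow> a 0 = 0" "k = 0 \<Longrightarrow> p 0 = 0" and s: "0 < s" and \<theta>: "0 < \<theta>" "\<theta> \<le> 1 - s / 2" and D: "\<bar>d\<bar> \<le> D"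
    and t: "t \<ge> 0"
  shows "(a t)\<^sup>2 + (b t)\<^sup>2 + (p t)\<^sup>2 + (q t)\<^sup>2 \<le>
    (4 / \<theta> + 16 * D\<^sup>2 / \<theta> ^ 3) * (1 + t\<^sup>2) * exp (- s * t) * ((a 0)\<^sup>2 + (b 0)\<^sup>2 + (p 0)\<^sup>2 + (q 0)\<^sup>2)"
proof -
  \<comment> \<open>For \<open>k = 0\<close> this is \<open>0\<close>, and the same energies serve the mean mode.\<close>
  define \<mu> where "\<mu> = s / k"
  have s2: "s \<le> 2" using \<theta> by simp
  have \<mu>: "\<bar>\<mu>\<bar> \<le> s"
  proof (cases "k = 0")
    case False
    then have "1 \<le> \<bar>real_of_int k\<bar>" by linarith
    then show ?thesis
      using mult_left_mono [of 1 "\<bar>real_of_int k\<bar>" s] s by (simp add: \<mu>_def abs_divide pos_divide_le_eq)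
  qed (use s in \<open>simp add: \<mu>_def\<close>)
  have \<mu>k: "\<mu> * k = s" if "k \<noteq> 0" using that by (simp add: \<mu>_def)
  \<comment> \<open>For \<open>k = 0\<close> both \<open>a\<close> and \<open>p\<close> have zero
    derivative, so they keep their initial value 0.\<close>
  have zero: "a r = 0 \<and> p r = 0" if "k = 0" "r \<ge> 0" for r
  proof -
    have "\<exists>c. \<forall>x\<in>{0..}. y x = c" if "\<And>t. t \<ge> 0 \<Longrightarrow> (y has_real_derivative 0) (at t within {0..})" for y
      using that by (intro has_field_derivative_zero_constant) auto
    from this [of a] this [of p] show ?thesis
      using a p mean that by fastforce
  qed
  define E where "E t = (a t)\<^sup>2 + (b t)\<^sup>2 + \<mu> * (a t * b t)" for t
  define F where "F t = (p t)\<^sup>2 + (q t)\<^sup>2 + \<mu> * (p t * q t)" for t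
  \<comment> \<open>This is the contribution of the source \<open>- d * b\<close> to the derivative
    of \<open>F\<close>, namely the source times the partial derivative of \<open>F\<close> in
    \<open>q\<close>.\<close>
  define h where "h t = - d * b t * (2 * q t + \<mu> * p t)" for t
  \<comment> \<open>Chosen so that \<open>4 * m\<close> is the product of \<open>D\<^sup>2\<close>,
    the factor \<open>4 / \<theta>\<close> from the decay of \<open>b\<close>, the factor
    \<open>8 / \<theta>\<close> bounding the square of \<open>2 * q + \<mu> * p\<close> by
    \<open>F\<close>, and the initial size of \<open>(a, b)\<close>.\<close>
  define m where "m = 8 * D\<^sup>2 / \<theta>\<^sup>2 * ((a 0)\<^sup>2 + (b 0)\<^sup>2)"
  have lower: "\<theta> * (x\<^sup>2 + y\<^sup>2) \<le> x\<^sup>2 + y\<^sup>2 + \<mu> * (x * y)" for x y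
    using twisted_energy_bounds(1) [OF \<mu> s2, of x y] mult_right_mono [OF \<theta>(2), of "x\<^sup>2 + y\<^sup>2"] by simp
  have lE: "\<theta> * ((a r)\<^sup>2 + (b r)\<^sup>2) \<le> E r" and lF: "\<theta> * ((p r)\<^sup>2 + (q r)\<^sup>2) \<le> F r" for r
    unfolding E_def F_def by (rule lower)+
  have uE: "E 0 \<le> 2 * ((a 0)\<^sup>2 + (b 0)\<^sup>2)" and uF: "F 0 \<le> 2 * ((p 0)\<^sup>2 + (q 0)\<^sup>2)"
    unfolding E_def F_def by (rule twisted_energy_bounds(2) [OF \<mu> s2])+
  have E0: "0 \<le> E r" and F0: "0 \<le> F r" for r
    using lE [of r] lF [of r] \<theta>(1) by (meson add_nonneg_nonneg less_imp_le mult_nonneg_nonneg order_trans zero_le_power2)+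
  define E' where "E' r = 2 * a r * (of_int k * b r) + 2 * b r * (- of_int k * a r - s * b r)
      + \<mu> * (of_int k * b r * b r + a r * (- of_int k * a r - s * b r))" for r
  define F' where "F' r = 2 * p r * (of_int k * q r) + 2 * q r * (- of_int k * p r - s * q r - d * b r)
      + \<mu> * (of_int k * q r * q r + p r * (- of_int k * p r - s * q r - d * b r))" for r
  have dE: "(E has_real_derivative E' r) (at r within {0..})" if "r \<ge> 0" for r
    unfolding E_def [abs_def] E'_def
    by (auto intro!: derivative_eq_intros a [OF that] b [OF that] simp: algebra_simps)
  have dF: "(F has_real_derivative F' r) (at r within {0..})" if "r \<ge> 0" for r
    unfolding F_def [abs_def] F'_def
    by (auto intro!: derivative_eq_intros p [OF that] q [OF that] simp: algebra_simps)
  have E': "E' r \<le> - s * E r + 0" and F': "F' r \<le> - s * F r + h r" if "r \<ge> 0" for r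
  proof -
    have "E' r \<le> - s * E r + 0 \<and> F' r \<le> - s * F r + h r"
    proof (cases "k = 0")
      \<comment> \<open>Here \<open>\<mu> = 0\<close> and \<open>a\<close>, \<open>p\<close> vanish,
        so the energies are the squares of \<open>b\<close> and \<open>q\<close>. They are damped at
        rate \<open>2 * s\<close>, which is more than required, and only an inequality
        holds.\<close>
      case True
      then show ?thesis
        using zero [OF True that] s
        by (simp add: E'_def E_def F'_def F_def h_def algebra_simps power2_eq_square)
    next
      \<comment> \<open>Replacing \<open>s\<close> by \<open>\<mu> * k\<close> turns both claims
        into polynomial identities: the cross term moves half of the damping of \<open>b\<close>
        over to \<open>a\<close>.\<close>
      case False
      have "E' r = - s * E r"
        unfolding E'_def E_def \<mu>k [OF False, symmetric] by algebra
      moreover have "F' r = - s * F r + h r"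
        unfolding F'_def F_def h_def \<mu>k [OF False, symmetric] by algebra
      ultimately show ?thesis by simp
    qed
    then show "E' r \<le> - s * E r + 0" "F' r \<le> - s * F r + h r" by auto
  qed
  have Edecay: "(a r)\<^sup>2 + (b r)\<^sup>2 \<le> 4 / \<theta> * ((a 0)\<^sup>2 + (b 0)\<^sup>2) * exp (- s * r)" if r: "r \<ge> 0" for r
  proof -
    have "E r \<le> 2 * (E 0 + 0 * r\<^sup>2) * exp (- s * r)"
      by (rule forced_decay [where h = "\<lambda>_. 0", OF dE]) (use E0 E' r in auto)
    also have "\<dots> \<le> 2 * (2 * ((a 0)\<^sup>2 + (b 0)\<^sup>2)) * exp (- s * r)"
      using uE by (intro mult_right_mono) auto
    finally have "\<theta> * ((a r)\<^sup>2 + (b r)\<^sup>2) \<le> 4 * ((a 0)\<^sup>2 + (b 0)\<^sup>2) * exp (- s * r)"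
      using lE [of r] by simp
    then show ?thesis using \<theta>(1) by (simp add: field_simps)
  qed
  have hbound: "(h r)\<^sup>2 \<le> 4 * m * exp (- s * r) * F r" if r: "r \<ge> 0" for r
  proof -
    have "(2 * q r + \<mu> * p r)\<^sup>2 \<le> 2 * (2 * q r)\<^sup>2 + 2 * (\<mu> * p r)\<^sup>2"
      using sum_squares_bound [of "2 * q r" "\<mu> * p r"] by (simp add: power2_sum)
    also have "\<dots> \<le> 8 * ((p r)\<^sup>2 + (q r)\<^sup>2)"
    proof -
      have "\<mu>\<^sup>2 \<le> 2\<^sup>2" using \<mu> s2 by (intro power2_le_iff_abs_le [THEN iffD2]) auto
      then have "\<mu>\<^sup>2 * (p r)\<^sup>2 \<le> 2\<^sup>2 * (p r)\<^sup>2" by (intro mult_right_mono) auto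
      then show ?thesis by (simp add: power_mult_distrib)
    qed
    also have "\<dots> \<le> 8 / \<theta> * F r"
      using lF [of r] \<theta>(1) by (simp add: field_simps)
    finally have 1: "(2 * q r + \<mu> * p r)\<^sup>2 \<le> 8 / \<theta> * F r" .
    have "d\<^sup>2 \<le> D\<^sup>2" using power_mono [OF D, of 2] by simp
    moreover have "(b r)\<^sup>2 \<le> 4 / \<theta> * ((a 0)\<^sup>2 + (b 0)\<^sup>2) * exp (- s * r)"
      using Edecay [OF r] by (smt (verit) zero_le_power2)
    ultimately have 2: "d\<^sup>2 * (b r)\<^sup>2 \<le> D\<^sup>2 * (4 / \<theta> * ((a 0)\<^sup>2 + (b 0)\<^sup>2) * exp (- s * r))"
      by (intro mult_mono) auto
    have "(h r)\<^sup>2 = d\<^sup>2 * (b r)\<^sup>2 * (2 * q r + \<mu> * p r)\<^sup>2"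
      by (simp add: h_def power_mult_distrib)
    also have "\<dots> \<le> D\<^sup>2 * (4 / \<theta> * ((a 0)\<^sup>2 + (b 0)\<^sup>2) * exp (- s * r)) * (8 / \<theta> * F r)"
      using \<theta>(1) by (intro mult_mono [OF 2 1]) auto
    also have "\<dots> = 4 * m * exp (- s * r) * F r"
      by (simp add: m_def power2_eq_square)
    finally show ?thesis .
  qed
  have "0 \<le> m" by (simp add: m_def)
  have "F t \<le> 2 * (F 0 + m * t\<^sup>2) * exp (- s * t)"
    by (rule forced_decay [where h = h, OF dF]) (use F0 F' hbound \<open>0 \<le> m\<close> t in auto)
  also have "\<dots> \<le> 2 * (2 * ((p 0)\<^sup>2 + (q 0)\<^sup>2) + m * t\<^sup>2) * exp (- s * t)"
    using uF by (intro mult_right_mono) auto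
  finally have "\<theta> * ((p t)\<^sup>2 + (q t)\<^sup>2) \<le> 2 * (2 * ((p 0)\<^sup>2 + (q 0)\<^sup>2) + m * t\<^sup>2) * exp (- s * t)"
    using lF [of t] by linarith
  then have "(p t)\<^sup>2 + (q t)\<^sup>2 \<le> 2 * (2 * ((p 0)\<^sup>2 + (q 0)\<^sup>2) + m * t\<^sup>2) * exp (- s * t) / \<theta>"
    using \<theta>(1) by (simp add: pos_le_divide_eq mult.commute)
  also have "\<dots> = (4 / \<theta> * ((p 0)\<^sup>2 + (q 0)\<^sup>2) + 16 * D\<^sup>2 / \<theta> ^ 3 * t\<^sup>2 * ((a 0)\<^sup>2 + (b 0)\<^sup>2)) * exp (- s * t)"
    using \<theta>(1) by (simp add: m_def field_simps power2_eq_square power3_eq_cube)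
  finally have "(a t)\<^sup>2 + (b t)\<^sup>2 + (p t)\<^sup>2 + (q t)\<^sup>2 \<le>
      (4 / \<theta> * ((a 0)\<^sup>2 + (b 0)\<^sup>2) + 4 / \<theta> * ((p 0)\<^sup>2 + (q 0)\<^sup>2)
        + 16 * D\<^sup>2 / \<theta> ^ 3 * t\<^sup>2 * ((a 0)\<^sup>2 + (b 0)\<^sup>2)) * exp (- s * t)"
    using Edecay [OF t] by (simp add: distrib_right)
  also have "\<dots> \<le> ((4 / \<theta> + 16 * D\<^sup>2 / \<theta> ^ 3) * (1 + t\<^sup>2) * ((a 0)\<^sup>2 + (b 0)\<^sup>2 + (p 0)\<^sup>2 + (q 0)\<^sup>2)) * exp (- s * t)"
  proof (rule mult_right_mono)
    define A where "A = 4 / \<theta>"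
    define B where "B = 16 * D\<^sup>2 / \<theta> ^ 3"
    define X where "X = (a 0)\<^sup>2 + (b 0)\<^sup>2"
    define Z where "Z = (p 0)\<^sup>2 + (q 0)\<^sup>2"
    have nn: "0 \<le> A" "0 \<le> B" "0 \<le> X" "0 \<le> Z" "0 \<le> t\<^sup>2" using \<theta>(1) by (auto simp: A_def B_def X_def Z_def)
    have "A * X + A * Z + B * t\<^sup>2 * X \<le> (A + B) * (1 + t\<^sup>2) * (X + Z)"
    proof -
      have "(A + B) * (1 + t\<^sup>2) * (X + Z) - (A * X + A * Z + B * t\<^sup>2 * X) =
        A * t\<^sup>2 * (X + Z) + B * (X + Z) + B * t\<^sup>2 * Z" by (simp add: algebra_simps)
      also have "\<dots> \<ge> 0" using nn by (intro add_nonneg_nonneg mult_nonneg_nonneg) auto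
      finally show ?thesis by simp
    qed
    then show "4 / \<theta> * ((a 0)\<^sup>2 + (b 0)\<^sup>2) + 4 / \<theta> * ((p 0)\<^sup>2 + (q 0)\<^sup>2)
        + 16 * D\<^sup>2 / \<theta> ^ 3 * t\<^sup>2 * ((a 0)\<^sup>2 + (b 0)\<^sup>2)
      \<le> (4 / \<theta> + 16 * D\<^sup>2 / \<theta> ^ 3) * (1 + t\<^sup>2) * ((a 0)\<^sup>2 + (b 0)\<^sup>2 + (p 0)\<^sup>2 + (q 0)\<^sup>2)"
      unfolding A_def B_def X_def Z_def by (simp add: add.assoc)
  qed simp
  finally show ?thesis by (simp add: mult_ac)
qed

section \<open>Decay of weak solutions\<close>

lemma smooth_periodicD:
  assumes "smooth_periodic \<phi>"
  shows "(\<phi> has_real_derivative deriv \<phi> x) (at x)" "continuous_on A \<phi>" "continuous_on A (deriv \<phi>)"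
    "\<phi> (2 * pi) = \<phi> 0"
proof -
  have d: "(deriv ^^ n) \<phi> differentiable (at x)" for n x
    using assms by (simp add: smooth_periodic_def)
  show "(\<phi> has_real_derivative deriv \<phi> x) (at x)"
    using d [of 0 x] by (simp add: DERIV_deriv_iff_real_differentiable)
  have "continuous_on UNIV ((deriv ^^ n) \<phi>)" for n
    using d by (intro differentiable_imp_continuous_on) (simp add: differentiable_on_def)
  from this [of 0] this [of 1] show "continuous_on A \<phi>" "continuous_on A (deriv \<phi>)"
    by (auto intro: continuous_on_subset)
  show "\<phi> (2 * pi) = \<phi> 0"
    using assms unfolding smooth_periodic_def by (metis add_0)
qed

lemma integral_deriv_smooth_periodic:
  assumes "smooth_periodic \<phi>"
  shows "(LINT x|torus. deriv \<phi> x) = 0"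
proof -
  have "(deriv \<phi> has_integral \<phi> (2 * pi) - \<phi> 0) {0..2 * pi}"
    using smooth_periodicD(1) [OF assms]
    by (intro fundamental_theorem_of_calculus)
       (auto simp: has_real_derivative_iff_has_vector_derivative intro: has_vector_derivative_at_within)
  moreover have "integrable torus (deriv \<phi>)"
    by (intro integrable_torus_continuous smooth_periodicD assms)
  ultimately show ?thesis
    using lebesgue_integral_eq_integral smooth_periodicD(4) [OF assms]
    by (metis diff_self integral_unique lmeasurable_cbox sets_completionI_sets cbox_interval fmeasurableD)
qed

lemma integrable_torus_mult_continuous:
  fixes u g :: "real \<Rightarrow> real"
  assumes "integrable torus u" "continuous_on {0..2 * pi} g"
  shows "integrable torus (\<lambda>x. u x * g x)"
proof -
  obtain B where "\<And>x. x \<in> {0..2 * pi} \<Longrightarrow> \<bar>g x\<bar> \<le> B"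
    using compact_imp_bounded [OF compact_continuous_image [OF assms(2)]] unfolding bounded_iff by fastforce
  then show ?thesis
    using assms by (intro integrable_torus_mult continuous_measurable_torus)
qed

lemma pairing_shift:
  assumes "integrable torus u" "continuous_on {0..2 * pi} g"
  shows "pairing (\<lambda>x. u x - e) g = pairing u g - e * (LINT x|torus. g x)"
  using integrable_torus_mult_continuous [OF assms] integrable_torus_continuous [OF assms(2)]
  by (simp add: pairing_def left_diff_distrib)

text \<open>Constants are stationary: the derivative of a periodic test function has integral 0, and
  the pairing with the test function itself changes by an amount independent of time. This allows
  the equilibrium to be subtracted.\<close>

lemma weak_transport_shift:
  assumes w: "weak_transport c u S"
  shows "weak_transport c (\<lambda>x t. u x t - e) S"
  unfolding weak_transport_def
proof (intro conjI allI impI)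
  fix t :: real assume t: "0 \<le> t"
  show "integrable torus (\<lambda>x. u x t - e)" "integrable torus (\<lambda>x. S x t)"
    using w t integrable_torus_continuous [OF continuous_on_const, of e] unfolding weak_transport_def by auto
next
  fix \<phi> and t :: real assume \<phi>: "smooth_periodic \<phi>" and t: "0 \<le> t"
  have u: "integrable torus (\<lambda>x. u x r)" if "r \<ge> 0" for r
    using w that by (simp add: weak_transport_def)
  have "((\<lambda>s. pairing (\<lambda>x. u x s) \<phi> - e * (LINT x|torus. \<phi> x)) has_real_derivative
      (c * pairing (\<lambda>x. u x t) (deriv \<phi>) + pairing (\<lambda>x. S x t) \<phi>) - 0) (at t within {0..})"
    using w \<phi> t unfolding weak_transport_def by (intro derivative_intros) auto
  moreover have "pairing (\<lambda>x. u x t - e) (deriv \<phi>) = pairing (\<lambda>x. u x t) (deriv \<phi>)"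
    using integral_deriv_smooth_periodic [OF \<phi>]
    by (simp add: pairing_shift [OF u [OF t] smooth_periodicD(3) [OF \<phi>]])
  ultimately have "((\<lambda>s. pairing (\<lambda>x. u x s) \<phi> - e * (LINT x|torus. \<phi> x)) has_real_derivative
      c * pairing (\<lambda>x. u x t - e) (deriv \<phi>) + pairing (\<lambda>x. S x t) \<phi>) (at t within {0..})"
    by simp
  then show "((\<lambda>s. pairing (\<lambda>x. u x s - e) \<phi>) has_real_derivative
      c * pairing (\<lambda>x. u x t - e) (deriv \<phi>) + pairing (\<lambda>x. S x t) \<phi>) (at t within {0..})"
    by (rule has_field_derivative_transform_within [where d = 1])
       (use t pairing_shift [OF u smooth_periodicD(2) [OF \<phi>]] in auto)
qed

section \<open>Reduction to the mode equations\<close>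

lemma weak_transport_cas:
  assumes "weak_transport c u S" "t \<ge> 0"
  shows "((\<lambda>r. pairing (\<lambda>x. u x r) (cas k)) has_real_derivative
      c * (of_int k * pairing (\<lambda>x. u x t) (cas (- k))) + pairing (\<lambda>x. S x t) (cas k)) (at t within {0..})"
proof -
  have "pairing (\<lambda>x. u x t) (deriv (cas k)) = of_int k * pairing (\<lambda>x. u x t) (cas (- k))"
    by (simp add: deriv_cas pairing_def mult.left_commute)
  moreover have "((\<lambda>r. pairing (\<lambda>x. u x r) (cas k)) has_real_derivative
      c * pairing (\<lambda>x. u x t) (deriv (cas k)) + pairing (\<lambda>x. S x t) (cas k)) (at t within {0..})"
    using assms smooth_periodic_cas [of k] unfolding weak_transport_def by blast
  ultimately show ?thesis by simp
qed

text \<open>The opposite speeds couple the sum at frequency \<open>k\<close> to the difference at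
  \<open>- k\<close>; the opposite sources cancel in the sum and double in the difference.\<close>

lemma transport_pair_modes:
  assumes p: "weak_transport 1 fp S" and m: "weak_transport (-1) fm (\<lambda>x t. - S x t)" and t: "t \<ge> 0"
  shows "((\<lambda>r. pairing (\<lambda>x. fp x r) (cas k) + pairing (\<lambda>x. fm x r) (cas k)) has_real_derivative
      of_int k * (pairing (\<lambda>x. fp x t) (cas (- k)) - pairing (\<lambda>x. fm x t) (cas (- k)))) (at t within {0..})"
    and "((\<lambda>r. pairing (\<lambda>x. fp x r) (cas (- k)) - pairing (\<lambda>x. fm x r) (cas (- k))) has_real_derivative
      - of_int k * (pairing (\<lambda>x. fp x t) (cas k) + pairing (\<lambda>x. fm x t) (cas k))
        + 2 * pairing (\<lambda>x. S x t) (cas (- k))) (at t within {0..})"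
proof -
  have S: "pairing (\<lambda>x. - S x t) g = - pairing (\<lambda>x. S x t) g" for g
    by (simp add: pairing_def)
  show "((\<lambda>r. pairing (\<lambda>x. fp x r) (cas k) + pairing (\<lambda>x. fm x r) (cas k)) has_real_derivative
      of_int k * (pairing (\<lambda>x. fp x t) (cas (- k)) - pairing (\<lambda>x. fm x t) (cas (- k)))) (at t within {0..})"
    using DERIV_add [OF weak_transport_cas [OF p t, of k] weak_transport_cas [OF m t, of k]]
    by (simp add: S algebra_simps)
  show "((\<lambda>r. pairing (\<lambda>x. fp x r) (cas (- k)) - pairing (\<lambda>x. fm x r) (cas (- k))) has_real_derivative
      - of_int k * (pairing (\<lambda>x. fp x t) (cas k) + pairing (\<lambda>x. fm x t) (cas k))
        + 2 * pairing (\<lambda>x. S x t) (cas (- k))) (at t within {0..})"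
    using DERIV_diff [OF weak_transport_cas [OF p t, of "- k"] weak_transport_cas [OF m t, of "- k"]]
    by (simp add: S algebra_simps)
qed

definition sq_sum4 :: "(real \<Rightarrow> real \<Rightarrow> real) \<Rightarrow> (real \<Rightarrow> real \<Rightarrow> real) \<Rightarrow> (real \<Rightarrow> real \<Rightarrow> real)
    \<Rightarrow> (real \<Rightarrow> real \<Rightarrow> real) \<Rightarrow> real \<Rightarrow> real \<Rightarrow> real"
  where "sq_sum4 fp fm gp gm x t = (fp x t)\<^sup>2 + (fm x t)\<^sup>2 + (gp x t)\<^sup>2 + (gm x t)\<^sup>2"

text \<open>Bessel's inequality bounds the coefficients at time 0, \<open>mode_decay\<close>
  propagates the bound to time \<open>t\<close>, and
  \<open>nn_integral_square_le_of_coefficients\<close> turns it back into an integral bound.\<close>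

lemma L2_decay_mean_zero:
  fixes fp fm gp gm :: "real \<Rightarrow> real \<Rightarrow> real" and s d D \<theta> :: real
  assumes fp: "weak_transport 1 fp (\<lambda>x t. s / 2 * (fm x t - fp x t))"
    and fm: "weak_transport (-1) fm (\<lambda>x t. - (s / 2 * (fm x t - fp x t)))"
    and gp: "weak_transport 1 gp (\<lambda>x t. s / 2 * (gm x t - gp x t) + d / 2 * (fm x t - fp x t))"
    and gm: "weak_transport (-1) gm (\<lambda>x t. - (s / 2 * (gm x t - gp x t) + d / 2 * (fm x t - fp x t)))"
    and mf: "(LINT x|torus. fp x 0) + (LINT x|torus. fm x 0) = 0"
    and mg: "(LINT x|torus. gp x 0) + (LINT x|torus. gm x 0) = 0"
    and s: "0 < s" and \<theta>: "0 < \<theta>" "\<theta> \<le> 1 - s / 2" and D: "\<bar>d\<bar> \<le> D" and t: "t \<ge> 0"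
  shows "(\<integral>\<^sup>+ x. ennreal (sq_sum4 fp fm gp gm x t) \<partial>torus) \<le>
    ennreal (4 * (4 / \<theta> + 16 * D\<^sup>2 / \<theta> ^ 3) * (1 + t\<^sup>2) * exp (- s * t)) *
    (\<integral>\<^sup>+ x. ennreal (sq_sum4 fp fm gp gm x 0) \<partial>torus)"
proof (cases "(\<integral>\<^sup>+ x. ennreal (sq_sum4 fp fm gp gm x 0) \<partial>torus) = \<infinity>")
  \<comment> \<open>With an infinite initial norm the right-hand side is infinite, because the
    factor in front of it is strictly positive.\<close>
  case True
  have "0 < 4 / \<theta> + 16 * D\<^sup>2 / \<theta> ^ 3"
    using \<theta>(1) by (intro add_pos_nonneg) auto
  then have "0 < 4 * (4 / \<theta> + 16 * D\<^sup>2 / \<theta> ^ 3) * (1 + t\<^sup>2) * exp (- s * t)"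
    by (intro mult_pos_pos) (simp_all add: add_pos_nonneg)
  then have "ennreal (4 * (4 / \<theta> + 16 * D\<^sup>2 / \<theta> ^ 3) * (1 + t\<^sup>2) * exp (- s * t)) \<noteq> 0"
    by (simp only: ennreal_eq_0_iff not_le)
  then show ?thesis
    by (simp only: True infinity_ennreal_def ennreal_mult_top top_greatest if_False)
next
  case False
  define G where "G = (4 / \<theta> + 16 * D\<^sup>2 / \<theta> ^ 3) * (1 + t\<^sup>2) * exp (- s * t)"
  have G0: "0 \<le> G" using \<theta>(1) by (auto simp: G_def intro!: mult_nonneg_nonneg add_nonneg_nonneg)
  have ifp: "integrable torus (\<lambda>x. fp x r)" and ifm: "integrable torus (\<lambda>x. fm x r)"
    and igp: "integrable torus (\<lambda>x. gp x r)" and igm: "integrable torus (\<lambda>x. gm x r)" if "r \<ge> 0" for r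
    using fp fm gp gm that by (auto simp: weak_transport_def)
  have mfp [measurable]: "(\<lambda>x. fp x r) \<in> borel_measurable torus"
    and mfm [measurable]: "(\<lambda>x. fm x r) \<in> borel_measurable torus"
    and mgp [measurable]: "(\<lambda>x. gp x r) \<in> borel_measurable torus"
    and mgm [measurable]: "(\<lambda>x. gm x r) \<in> borel_measurable torus" if "r \<ge> 0" for r
    using ifp [OF that] ifm [OF that] igp [OF that] igm [OF that] by auto
  define mode where "mode r k = (pairing (\<lambda>x. fp x r) (cas k))\<^sup>2 + (pairing (\<lambda>x. fm x r) (cas k))\<^sup>2
      + (pairing (\<lambda>x. gp x r) (cas k))\<^sup>2 + (pairing (\<lambda>x. gm x r) (cas k))\<^sup>2" for r k
  define a where "a k r = pairing (\<lambda>x. fp x r) (cas k) + pairing (\<lambda>x. fm x r) (cas k)" for k r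
  define b where "b k r = pairing (\<lambda>x. fp x r) (cas k) - pairing (\<lambda>x. fm x r) (cas k)" for k r
  define p where "p k r = pairing (\<lambda>x. gp x r) (cas k) + pairing (\<lambda>x. gm x r) (cas k)" for k r
  define q where "q k r = pairing (\<lambda>x. gp x r) (cas k) - pairing (\<lambda>x. gm x r) (cas k)" for k r
  have decay: "(a k t)\<^sup>2 + (b (- k) t)\<^sup>2 + (p k t)\<^sup>2 + (q (- k) t)\<^sup>2
      \<le> G * ((a k 0)\<^sup>2 + (b (- k) 0)\<^sup>2 + (p k 0)\<^sup>2 + (q (- k) 0)\<^sup>2)" for k
    unfolding G_def
  proof (rule mode_decay [OF _ _ _ _ _ _ s \<theta> D t])
    fix r :: real assume r: "r \<ge> 0"
    have Sf: "2 * pairing (\<lambda>x. s / 2 * (fm x r - fp x r)) (cas j) = - s * b j r" for j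
    proof -
      have "2 * pairing (\<lambda>x. s / 2 * (fm x r - fp x r)) (cas j)
          = 2 * (LINT x|torus. s / 2 * (fm x r * cas j x - fp x r * cas j x))"
        unfolding pairing_def by (simp add: left_diff_distrib mult.assoc)
      also have "\<dots> = - s * b j r"
        using integrable_torus_mult_cas [OF ifp [OF r], of j] integrable_torus_mult_cas [OF ifm [OF r], of j]
        by (simp add: b_def pairing_def algebra_simps)
      finally show ?thesis .
    qed
    have Sg: "2 * pairing (\<lambda>x. s / 2 * (gm x r - gp x r) + d / 2 * (fm x r - fp x r)) (cas j)
        = - s * q j r - d * b j r" for j
    proof -
      have "2 * pairing (\<lambda>x. s / 2 * (gm x r - gp x r) + d / 2 * (fm x r - fp x r)) (cas j)
          = 2 * (LINT x|torus. s / 2 * (gm x r * cas j x - gp x r * cas j x)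
              + d / 2 * (fm x r * cas j x - fp x r * cas j x))"
        unfolding pairing_def by (simp add: left_diff_distrib distrib_right mult.assoc)
      also have "\<dots> = - s * q j r - d * b j r"
        using integrable_torus_mult_cas [OF ifp [OF r], of j] integrable_torus_mult_cas [OF ifm [OF r], of j]
          integrable_torus_mult_cas [OF igp [OF r], of j] integrable_torus_mult_cas [OF igm [OF r], of j]
        by (simp add: b_def q_def pairing_def algebra_simps)
      finally show ?thesis .
    qed
    show "(a k has_real_derivative of_int k * b (- k) r) (at r within {0..})"
      using transport_pair_modes(1) [OF fp fm r, of k] by (simp add: a_def [abs_def] b_def)
    show "(b (- k) has_real_derivative - of_int k * a k r - s * b (- k) r) (at r within {0..})"
      using transport_pair_modes(2) [OF fp fm r, of k]
      unfolding Sf by (simp add: a_def b_def [abs_def] algebra_simps)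
    show "(p k has_real_derivative of_int k * q (- k) r) (at r within {0..})"
      using transport_pair_modes(1) [OF gp gm r, of k] by (simp add: p_def [abs_def] q_def)
    show "(q (- k) has_real_derivative - of_int k * p k r - s * q (- k) r - d * b (- k) r) (at r within {0..})"
      using transport_pair_modes(2) [OF gp gm r, of k]
      unfolding Sg by (simp add: p_def q_def [abs_def] algebra_simps)
  next
    show "a k 0 = 0" "p k 0 = 0" if "k = 0"
      using that mf mg by (simp_all add: a_def p_def cas_0 pairing_def)
  qed
  \<comment> \<open>The parallelogram identity passes from sums and differences back to the
    components; the symmetry of the index set permits replacing \<open>- k\<close> by
    \<open>k\<close> in the terms with \<open>b\<close> and \<open>q\<close>.\<close>
  have mode_eq: "2 * (\<Sum>k\<in>L. mode r k) = (\<Sum>k\<in>L. (a k r)\<^sup>2 + (b (- k) r)\<^sup>2 + (p k r)\<^sup>2 + (q (- k) r)\<^sup>2)"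
    if "uminus ` L = L" for L r
  proof -
    have refl: "(\<Sum>k\<in>L. g (- k)) = sum g L" for g :: "int \<Rightarrow> real"
      using sum.reindex [of uminus L g] that by simp
    have "2 * (\<Sum>k\<in>L. mode r k) = (\<Sum>k\<in>L. (a k r)\<^sup>2 + (b k r)\<^sup>2 + (p k r)\<^sup>2 + (q k r)\<^sup>2)"
      unfolding sum_distrib_left
      by (intro sum.cong) (simp_all add: mode_def a_def b_def p_def q_def power2_sum power2_diff)
    then show ?thesis
      by (simp add: sum.distrib refl [of "\<lambda>k. (b k r)\<^sup>2"] refl [of "\<lambda>k. (q k r)\<^sup>2"])
  qed
  have sq: "integrable torus (\<lambda>x. (w x)\<^sup>2)"
    if "w \<in> borel_measurable torus" "\<And>x. (w x)\<^sup>2 \<le> sq_sum4 fp fm gp gm x 0" for w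
  proof (rule integrableI_bounded)
    show "(\<lambda>x. (w x)\<^sup>2) \<in> borel_measurable torus" using that(1) by measurable
    have "(\<integral>\<^sup>+ x. ennreal (norm ((w x)\<^sup>2)) \<partial>torus) \<le> (\<integral>\<^sup>+ x. ennreal (sq_sum4 fp fm gp gm x 0) \<partial>torus)"
      using that(2) by (intro nn_integral_mono ennreal_leI) simp
    then show "(\<integral>\<^sup>+ x. ennreal (norm ((w x)\<^sup>2)) \<partial>torus) < \<infinity>"
      using False by (simp add: order_le_less_trans top.not_eq_extremum)
  qed
  have sqs: "integrable torus (\<lambda>x. (fp x 0)\<^sup>2)" "integrable torus (\<lambda>x. (fm x 0)\<^sup>2)"
    "integrable torus (\<lambda>x. (gp x 0)\<^sup>2)" "integrable torus (\<lambda>x. (gm x 0)\<^sup>2)"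
    by (intro sq; simp add: sq_sum4_def)+
  define I where "I = (LINT x|torus. sq_sum4 fp fm gp gm x 0)"
  have I: "(\<integral>\<^sup>+ x. ennreal (sq_sum4 fp fm gp gm x 0) \<partial>torus) = ennreal I"
    unfolding I_def sq_sum4_def using sqs by (intro nn_integral_eq_integral) auto
  have modes_le: "(\<Sum>k\<in>K. mode t k) \<le> 2 * pi * (G * I)" if K: "finite K" for K
  proof -
    \<comment> \<open>\<open>decay\<close> couples the modes \<open>k\<close> and \<open>- k\<close>, so the index set is made symmetric.\<close>
    define L where "L = K \<union> uminus ` K"
    have L: "finite L" "uminus ` L = L"
      using K by (auto simp: L_def image_Un image_image)
    have "(\<Sum>k\<in>K. mode t k) \<le> (\<Sum>k\<in>L. mode t k)"
      using L(1) by (intro sum_mono2) (auto simp: L_def mode_def)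
    also have "\<dots> = (\<Sum>k\<in>L. (a k t)\<^sup>2 + (b (- k) t)\<^sup>2 + (p k t)\<^sup>2 + (q (- k) t)\<^sup>2) / 2"
      using mode_eq [OF L(2), of t] by simp
    also have "\<dots> \<le> (\<Sum>k\<in>L. G * ((a k 0)\<^sup>2 + (b (- k) 0)\<^sup>2 + (p k 0)\<^sup>2 + (q (- k) 0)\<^sup>2)) / 2"
      by (intro divide_right_mono sum_mono decay) auto
    also have "\<dots> = G * (\<Sum>k\<in>L. mode 0 k)"
      using mode_eq [OF L(2), of 0] by (simp flip: sum_distrib_left)
    also have "(\<Sum>k\<in>L. mode 0 k) \<le> 2 * pi * I"
      using bessel_cas [OF ifp sqs(1) L(1)] bessel_cas [OF ifm sqs(2) L(1)]
        bessel_cas [OF igp sqs(3) L(1)] bessel_cas [OF igm sqs(4) L(1)] sqs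
      by (simp add: mode_def sum.distrib I_def sq_sum4_def distrib_left)
    then have "G * (\<Sum>k\<in>L. mode 0 k) \<le> G * (2 * pi * I)"
      using G0 by (intro mult_left_mono)
    finally show ?thesis by (simp add: mult_ac)
  qed
  \<comment> \<open>Each component is estimated by the bound \<open>G * I\<close> for all four
    together; adding the four estimates produces the factor 4 in the constant.\<close>
  have comp: "(\<integral>\<^sup>+ x. ennreal ((w x)\<^sup>2) \<partial>torus) \<le> ennreal (G * I)"
    if "integrable torus w" "\<And>k. (pairing w (cas k))\<^sup>2 \<le> mode t k" for w
    by (rule nn_integral_square_le_of_coefficients [OF that(1)])
       (rule order_trans [OF sum_mono [OF that(2)] modes_le])
  have "(\<integral>\<^sup>+ x. ennreal (sq_sum4 fp fm gp gm x t) \<partial>torus) =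
      (\<integral>\<^sup>+ x. ennreal ((fp x t)\<^sup>2) \<partial>torus) + (\<integral>\<^sup>+ x. ennreal ((fm x t)\<^sup>2) \<partial>torus)
      + (\<integral>\<^sup>+ x. ennreal ((gp x t)\<^sup>2) \<partial>torus) + (\<integral>\<^sup>+ x. ennreal ((gm x t)\<^sup>2) \<partial>torus)"
    using mfp [OF t] mfm [OF t] mgp [OF t] mgm [OF t]
    by (simp add: sq_sum4_def ennreal_plus nn_integral_add)
  also have "\<dots> \<le> ennreal (G * I) + ennreal (G * I) + ennreal (G * I) + ennreal (G * I)"
    using t by (intro add_mono comp ifp ifm igp igm) (auto simp: mode_def)
  also have "\<dots> = ennreal (4 * G) * ennreal I"
  proof -
    have "0 \<le> I" by (auto simp: I_def sq_sum4_def)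
    then show ?thesis using G0 by (simp flip: ennreal_plus ennreal_mult)
  qed
  finally show ?thesis unfolding I G_def by (simp only: mult.assoc)
qed

text \<open>The set where the bound fails is open and null, hence empty. It turns the essential
  bound on the derivative of \<sigma> into one valid at every parameter.\<close>

lemma continuous_AE_bounded:
  fixes f :: "real \<Rightarrow> real"
  assumes "continuous_on UNIV f" "AE z in lebesgue. \<bar>f z\<bar> \<le> K"
  shows "\<bar>f z\<bar> \<le> K"
proof (rule ccontr)
  assume "\<not> \<bar>f z\<bar> \<le> K"
  moreover have "open {z. K < \<bar>f z\<bar>}"
    using assms(1) by (intro open_Collect_less continuous_intros)
  moreover have "negligible {z. K < \<bar>f z\<bar>}"
    using assms(2) by (simp add: negligible_iff_null_sets not_le completion.AE_iff_null_sets)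
  ultimately show False
    using open_not_negligible by (metis (mono_tags, lifting) empty_iff mem_Collect_eq not_le)
qed

section \<open>Distance to equilibrium and uniformity in the parameter\<close>

lemma norm_sq_minus_Phi_inf:
  "(norm (v - Phi_inf))\<^sup>2 = (v $ 1 - 1 / 2)\<^sup>2 + (v $ 2 - 1 / 2)\<^sup>2 + (v $ 3)\<^sup>2 + (v $ 4)\<^sup>2"
proof -
  have Phi_inf: "Phi_inf $ 1 = 1 / 2" "Phi_inf $ 2 = 1 / 2" "Phi_inf $ 3 = 0" "Phi_inf $ 4 = 0"
    unfolding Phi_inf_def vector_def by simp_all
  show ?thesis
    unfolding power2_norm_eq_inner inner_vec_def sum_4 vector_minus_component Phi_inf
    by (simp add: power2_eq_square)
qed

theorem theorem4p1:
  fixes \<sigma> :: "real \<Rightarrow> real"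
  assumes "\<forall>z. \<sigma> differentiable (at z)" and "continuous_on UNIV (deriv \<sigma>)"
    and "bdd_below (range \<sigma>)" and "0 < (INF z. \<sigma> z)"
    and "bdd_above (range \<sigma>)" and "(SUP z. \<sigma> z) < 2"
    and "\<exists>K. AE z in lebesgue. \<bar>deriv \<sigma> z\<bar> \<le> K"
  shows "\<exists>C>0. \<forall>\<Phi> :: real \<Rightarrow> real \<Rightarrow> real \<Rightarrow> real^4.
    goldstein_taylor_solution \<sigma> \<Phi> \<and> normalized \<Phi> \<longrightarrow>
    (\<forall>t\<ge>0. (SUP z. L2_norm_sq (\<lambda>x. \<Phi> x z t - Phi_inf))
      \<le> ennreal (C * (1 + t\<^sup>2) * exp (- (INF z. \<sigma> z) * t)) *
        (SUP z. L2_norm_sq (\<lambda>x. \<Phi> x z 0 - Phi_inf)))"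
proof -
  obtain D where D: "\<And>z. \<bar>deriv \<sigma> z\<bar> \<le> D"
    using assms(2,7) continuous_AE_bounded by blast
  \<comment> \<open>A lower energy constant that serves all \<open>z\<close> at once; it is positive
    because the supremum of \<sigma> is below 2.\<close>
  define \<theta> where "\<theta> = 1 - (SUP z. \<sigma> z) / 2"
  define C where "C = 4 * (4 / \<theta> + 16 * D\<^sup>2 / \<theta> ^ 3)"
  have \<theta>: "0 < \<theta>" using assms(6) by (simp add: \<theta>_def)
  have C: "0 < C" unfolding C_def using \<theta> by (intro mult_pos_pos add_pos_nonneg) auto
  have lower: "(INF z. \<sigma> z) \<le> \<sigma> z" and upper: "\<theta> \<le> 1 - \<sigma> z / 2" for z
    using cINF_lower [OF assms(3)] cSUP_upper [OF _ assms(5)] by (auto simp: \<theta>_def)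
  have fixed_z: "L2_norm_sq (\<lambda>x. \<Phi> x z t - Phi_inf)
      \<le> ennreal (C * (1 + t\<^sup>2) * exp (- (INF z. \<sigma> z) * t)) * L2_norm_sq (\<lambda>x. \<Phi> x z 0 - Phi_inf)"
    if sol: "goldstein_taylor_solution \<sigma> \<Phi>" and norm: "normalized \<Phi>" and t: "t \<ge> 0" for \<Phi> z t
  proof -
    define fp where "fp z x t = \<Phi> x z t $ 1 - 1 / 2" for z x t
    define fm where "fm z x t = \<Phi> x z t $ 2 - 1 / 2" for z x t
    define gp where "gp z x t = \<Phi> x z t $ 3" for z x t
    define gm where "gm z x t = \<Phi> x z t $ 4" for z x t
    have w1: "weak_transport 1 (fp z) (\<lambda>x t. \<sigma> z / 2 * (fm z x t - fp z x t))"
      and w2: "weak_transport (-1) (fm z) (\<lambda>x t. - (\<sigma> z / 2 * (fm z x t - fp z x t)))" for z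
      using sol weak_transport_shift [of 1 "\<lambda>x t. \<Phi> x z t $ 1" _ "1 / 2"]
        weak_transport_shift [of "-1" "\<lambda>x t. \<Phi> x z t $ 2" _ "1 / 2"]
      unfolding goldstein_taylor_solution_def Let_def fp_def fm_def by simp_all
    have w3: "weak_transport 1 (gp z) (\<lambda>x t. \<sigma> z / 2 * (gm z x t - gp z x t) + deriv \<sigma> z / 2 * (fm z x t - fp z x t))"
      and w4: "weak_transport (-1) (gm z) (\<lambda>x t. - (\<sigma> z / 2 * (gm z x t - gp z x t) + deriv \<sigma> z / 2 * (fm z x t - fp z x t)))" for z
      using sol unfolding goldstein_taylor_solution_def Let_def fp_def fm_def gp_def gm_def by simp_all
    have total: "(LINT x|torus. \<Phi> x z 0 $ 1) + (LINT x|torus. \<Phi> x z 0 $ 2) = 2 * pi" for z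
    proof -
      have "integrable torus (\<lambda>x. \<Phi> x z 0 $ 1)" "integrable torus (\<lambda>x. \<Phi> x z 0 $ 2)"
        using sol unfolding goldstein_taylor_solution_def Let_def parameter_derivative_def by auto
      then have "(LINT x|torus. \<Phi> x z 0 $ 1) + (LINT x|torus. \<Phi> x z 0 $ 2) = (LINT x|torus. \<Phi> x z 0 $ 1 + \<Phi> x z 0 $ 2)"
        by simp
      also have "\<dots> = 2 * pi"
        using norm by (simp add: normalized_def field_simps)
      finally show ?thesis .
    qed
    have mf: "(LINT x|torus. fp z x 0) + (LINT x|torus. fm z x 0) = 0"
    proof -
      have "integrable torus (\<lambda>x. \<Phi> x z 0 $ 1)" "integrable torus (\<lambda>x. \<Phi> x z 0 $ 2)"
        using sol unfolding goldstein_taylor_solution_def Let_def parameter_derivative_def by auto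
      then show ?thesis
        using pairing_shift [of _ "cas 0" "1 / 2", OF _ continuous_on_cas] total [of z]
        by (simp add: fp_def fm_def pairing_def integral_cas) (simp add: cas_0)
    qed
    \<comment> \<open>The total mass of \<open>f\<close> at time 0 is \<open>2 * pi\<close> for
      every parameter. Testing the parameter derivative with the constant function
      \<open>cas 0\<close> shows that the mass of \<open>g\<close> is the derivative of this
      constant.\<close>
    have mg: "(LINT x|torus. gp z x 0) + (LINT x|torus. gm z x 0) = 0"
    proof -
      have "((\<lambda>y. pairing (\<lambda>x. \<Phi> x y 0 $ 1) (cas 0)) has_real_derivative pairing (\<lambda>x. gp z x 0) (cas 0)) (at z)"
        "((\<lambda>y. pairing (\<lambda>x. \<Phi> x y 0 $ 2) (cas 0)) has_real_derivative pairing (\<lambda>x. gm z x 0) (cas 0)) (at z)"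
        using sol smooth_periodic_cas [of 0]
        unfolding goldstein_taylor_solution_def Let_def parameter_derivative_def gp_def gm_def by auto
      from DERIV_add [OF this]
      have "((\<lambda>y. 2 * pi) has_real_derivative (LINT x|torus. gp z x 0) + (LINT x|torus. gm z x 0)) (at z)"
        by (simp add: pairing_def cas_0 total)
      then show ?thesis
        using DERIV_unique DERIV_const by blast
    qed
    have "L2_norm_sq (\<lambda>x. \<Phi> x z t - Phi_inf) \<le>
        ennreal (C * (1 + t\<^sup>2) * exp (- \<sigma> z * t)) * L2_norm_sq (\<lambda>x. \<Phi> x z 0 - Phi_inf)"
      using L2_decay_mean_zero [OF w1 w2 w3 w4 mf mg _ \<theta> upper D t] assms(4) lower [of z]
      unfolding L2_norm_sq_def norm_sq_minus_Phi_inf sq_sum4_def C_def fp_def fm_def gp_def gm_def by simp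
    \<comment> \<open>The decay rate \<open>\<sigma> z\<close> is at least the infimum and
      \<open>t\<close> is nonnegative, so the slowest exponential dominates.\<close>
    also have "\<dots> \<le> ennreal (C * (1 + t\<^sup>2) * exp (- (INF z. \<sigma> z) * t)) * L2_norm_sq (\<lambda>x. \<Phi> x z 0 - Phi_inf)"
      using C t lower [of z] by (intro mult_right_mono ennreal_leI mult_left_mono) (auto intro: mult_right_mono)
    finally show ?thesis .
  qed
  show ?thesis
  proof (intro exI [of _ C] conjI allI impI C SUP_least)
    fix \<Phi> :: "real \<Rightarrow> real \<Rightarrow> real \<Rightarrow> real^4" and t z :: real
    assume "goldstein_taylor_solution \<sigma> \<Phi> \<and> normalized \<Phi>" and "0 \<le> t"
    then show "L2_norm_sq (\<lambda>x. \<Phi> x z t - Phi_inf)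
      \<le> ennreal (C * (1 + t\<^sup>2) * exp (- (INF z. \<sigma> z) * t)) * (SUP z. L2_norm_sq (\<lambda>x. \<Phi> x z 0 - Phi_inf))"
      by (intro order_trans [OF fixed_z] mult_left_mono SUP_upper) auto
  qed
qed

end
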